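(* Let $\mathcal{S}(\mathrm{R})$ be an o-minimal structure over a real closed field $\mathrm{R}$, and let $F$ be a closed definable subset of $\mathrm{R}^\ell \times \mathrm{R}^\ell$. Then there exists a constant $\varepsilon = \varepsilon(F)$, $1 > \varepsilon > 0$, depending only on $F$, such that for any set of $n$ points $\mathcal{F} = \{\mathbf{y}_1,\ldots,\mathbf{y}_n\} \subset \mathrm{R}^{\ell}$ there exist two subfamilies $\mathcal{F}_1,\mathcal{F}_2 \subset \mathcal{F}$ with $|\mathcal{F}_1|, |\mathcal{F}_2| \geq \varepsilon n$ and either (1) for all $\mathbf{y}_i \in \mathcal{F}_1$ and $\mathbf{y}_j \in \mathcal{F}_2$, $(\mathbf{y}_i,\mathbf{y}_j) \in F$, or (2) for no $\mathbf{y}_i \in \mathcal{F}_1$ and $\mathbf{y}_j \in \mathcal{F}_2$, $(\mathbf{y}_i,\mathbf{y}_j) \in F$.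
   Context: An o-minimal structure on a real closed field $\mathrm{R}$ is a sequence $\mathcal{S}(\mathrm{R}) = (\mathcal{S}_n)_{n\in\mathbb{N}}$, each $\mathcal{S}_n$ a collection of subsets of $\mathrm{R}^n$ (the definable sets), such that: all algebraic subsets of $\mathrm{R}^n$ are in $\mathcal{S}_n$; $\mathcal{S}_n$ is closed under complementation, finite unions and finite intersections; $A\in\mathcal{S}_m$, $B\in\mathcal{S}_n$ imply $A\times B\in\mathcal{S}_{m+n}$; the image of $A\in\mathcal{S}_{n+1}$ under projection to the first $n$ coordinates is in $\mathcal{S}_n$; and the elements of $\mathcal{S}_1$ are precisely the finite unions of points and intervals. *)

theory Defs
  imports
    "HOL-Analysis.Function_Topology"
    "HOL-Computational_Algebra.Polynomial"
    "HOL-Library.Poly_Mapping"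
begin

text \<open>
  An ordered field whose nonnegative elements are squares and over which every polynomial
  of odd degree has a root. As in \<^class>\<open>alg_closed_field\<close>, the class axiom spells the
  polynomial out as a sum, since \<^const>\<open>poly\<close> cannot be used inside the class specification.
\<close>

class real_closed_field = linordered_field +
  assumes nonneg_is_square: "0 \<le> x \<Longrightarrow> \<exists>y. x = y * y"
    and odd_degree_has_zero: "odd n \<Longrightarrow> f n \<noteq> 0 \<Longrightarrow> \<exists>x. (\<Sum>k\<le>n. f k * x ^ k) = 0"

lemma odd_degree_has_root:
  fixes p :: "'a::real_closed_field poly"
  assumes "odd (degree p)"
  shows "\<exists>x. poly p x = 0"
proof -
  have "coeff p (degree p) \<noteq> 0"
    using assms by auto
  from odd_degree_has_zero[of "degree p" "coeff p", OF assms this] show ?thesis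
    by (simp add: poly_altdef)
qed

text \<open>
  Points of \<open>R\<^sup>n\<close> are lists of length \<open>n\<close>, so that \<open>R\<^sup>m \<times> R\<^sup>n\<close> is identified with
  \<open>R\<^bsup>m+n\<^esup>\<close> through list append. Coordinates are numbered from \<open>0\<close>.
\<close>

definition affine_space :: "nat \<Rightarrow> 'a list set" where
  "affine_space n = {x. length x = n}"

definition product_set :: "'a list set \<Rightarrow> 'a list set \<Rightarrow> 'a list set" where
  "product_set A B = {x @ y | x y. x \<in> A \<and> y \<in> B}"

text \<open>
  The squared distance is used because it is available before square roots are;
  for \<open>r > 0\<close> the ball is the usual Euclidean one.
\<close>

definition open_ball :: "nat \<Rightarrow> 'a::linordered_field list \<Rightarrow> 'a \<Rightarrow> 'a list set" where
  "open_ball n x r = {y \<in> affine_space n. (\<Sum>i<n. (y ! i - x ! i)\<^sup>2) < r\<^sup>2}"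

definition euclidean_space_topology :: "nat \<Rightarrow> 'a::linordered_field list topology" where
  "euclidean_space_topology n =
     topology_generated_by {open_ball n x r | x r. x \<in> affine_space n \<and> 0 < r}"

text \<open>
  A polynomial maps finitely many monomials to nonzero coefficients; a monomial maps
  finitely many variable indices to nonzero exponents.
\<close>

type_synonym 'a multipoly = "(nat \<Rightarrow>\<^sub>0 nat) \<Rightarrow>\<^sub>0 'a"

definition polynomials_in :: "nat \<Rightarrow> 'a::zero multipoly set" where
  "polynomials_in n = {p. \<forall>m \<in> Poly_Mapping.keys p. Poly_Mapping.keys m \<subseteq> {..<n}}"

definition eval_multipoly :: "'a::comm_semiring_1 multipoly \<Rightarrow> 'a list \<Rightarrow> 'a" where
  "eval_multipoly p x =
     (\<Sum>m \<in> Poly_Mapping.keys p. Poly_Mapping.lookup p m *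
        (\<Prod>i \<in> Poly_Mapping.keys m. x ! i ^ Poly_Mapping.lookup m i))"

definition algebraic_set :: "nat \<Rightarrow> 'a::comm_semiring_1 list set \<Rightarrow> bool" where
  "algebraic_set n A \<longleftrightarrow>
     (\<exists>P. finite P \<and> P \<subseteq> polynomials_in n \<and>
          A = {x \<in> affine_space n. \<forall>p \<in> P. eval_multipoly p x = 0})"

text \<open>
  Endpoints of intervals lie in \<open>R \<union> {-\<infinity>, \<infinity>}\<close>; over a field that is not Dedekind
  complete this is more restrictive than order convexity. Half-open and closed intervals
  are finite unions of points and of the open intervals below.
\<close>

definition points_and_intervals :: "'a::linorder set set" where
  "points_and_intervals =
     range (\<lambda>a. {a}) \<union> {{a<..<b} | a b. a < b} \<union> range lessThan \<union> range greaterThan \<union> {UNIV}"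

text \<open>
  The index \<open>n = 0\<close> is allowed: both subsets of the one-point space \<open>R\<^sup>0\<close> are algebraic,
  so this imposes nothing on the \<open>S n\<close> with \<open>n \<ge> 1\<close>. Closure under empty unions and
  intersections follows from \<open>algebraic\<close>.
\<close>

locale o_minimal_structure =
  fixes S :: "nat \<Rightarrow> 'a::real_closed_field list set set"
  assumes subsets: "A \<in> S n \<Longrightarrow> A \<subseteq> affine_space n"
    and algebraic: "algebraic_set n A \<Longrightarrow> A \<in> S n"
    and complement: "A \<in> S n \<Longrightarrow> affine_space n - A \<in> S n"
    and union: "A \<in> S n \<Longrightarrow> B \<in> S n \<Longrightarrow> A \<union> B \<in> S n"
    and intersection: "A \<in> S n \<Longrightarrow> B \<in> S n \<Longrightarrow> A \<inter> B \<in> S n"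
    and product: "A \<in> S m \<Longrightarrow> B \<in> S n \<Longrightarrow> product_set A B \<in> S (m + n)"
    and projection: "A \<in> S (Suc n) \<Longrightarrow> take n ` A \<in> S n"
    and dimension_one:
      "S 1 = {(\<lambda>t. [t]) ` \<Union>C | C. finite C \<and> C \<subseteq> points_and_intervals}"

end

theory Submission
  imports Defs
begin

text \<open>
  A definable relation is shown to be distal in the combinatorial sense: every point lies in a cell
  that is determined by boundedly many of the given parameters and that no parameter crosses.
  For a one-dimensional variable the cells are intervals between endpoints of fibres, and this only
  needs the number of endpoints to be uniformly bounded; further coordinates are added one at a time,
  by asking for cells that fix, for triples of parameters, whether an interval with endpoints taken
  from the first two lies inside the fibre of the third. A random sample of bounded size then yields a
  cell that contains a positive fraction of the points and is crossed by at most half of the parameters.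

  Uniform finiteness needs no cell decomposition. For a definable family \<open>A\<^sub>s\<close> of finite sets over
  a line, the parameters \<open>s\<close> at which \<open>A\<close> is not locally a disjoint union of continuous graphs form a
  finite set that is itself definable in further parameters. Sampling \<open>A\<^sub>s\<close> between and at these
  exceptional \<open>s\<close> gives a finite set that dominates every \<open>|A\<^sub>s|\<close> and depends on one parameter less.
\<close>

section \<open>First-order definability\<close>

text \<open>The field need not be Archimedean or Dedekind complete, so suprema and continuity
  arguments are available only for definable sets. Hence every auxiliary set has to be proved
  definable, and definability is set up as closure under first-order formulas. Compactness of
  \<open>[-1, 1]\<close> is replaced by suprema of definable sets, and limits along
  \<open>1/n\<close> by families \<open>G c\<close> that grow as \<open>c\<close> decreases to zero.
  Endpoints of fibres are never turned into functions of the other coordinates: they enter only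
  through the statements that at least \<open>i\<close> of them lie below a value, strictly or
  weakly, which are first-order and monotone in that value. A cell helps at the end because the
  relation, restricted to it, depends on the parameter alone for every parameter that does not cross
  it; splitting these parameters by truth value gives the homogeneous pair.\<close>

named_theorems dfn_intros

lemma eval_multipoly_superset:
  assumes "finite M" "Poly_Mapping.keys p \<subseteq> M"
  shows "eval_multipoly p x =
    (\<Sum>m\<in>M. Poly_Mapping.lookup p m * (\<Prod>i\<in>Poly_Mapping.keys m. x ! i ^ Poly_Mapping.lookup m i))"
  unfolding eval_multipoly_def using assms
  by (intro sum.mono_neutral_left) (auto simp: in_keys_iff)

lemma eval_multipoly_add: "eval_multipoly (p + q) x = eval_multipoly p x + eval_multipoly q x"
proof -
  let ?M = "Poly_Mapping.keys p \<union> Poly_Mapping.keys q"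
  have "Poly_Mapping.keys (p + q) \<subseteq> ?M" by (rule Poly_Mapping.keys_add)
  then show ?thesis
    using eval_multipoly_superset[of ?M "p + q" x] eval_multipoly_superset[of ?M p x]
      eval_multipoly_superset[of ?M q x]
    by (simp add: lookup_add algebra_simps sum.distrib)
qed

lemma eval_multipoly_single:
  "eval_multipoly (Poly_Mapping.single m c) x =
    c * (\<Prod>i\<in>Poly_Mapping.keys m. x ! i ^ Poly_Mapping.lookup m i)"
  by (subst eval_multipoly_superset[of "{m}"]) auto

definition coord :: "nat \<Rightarrow> 'a::comm_ring_1 \<Rightarrow> 'a multipoly" where
  "coord i c = Poly_Mapping.single (Poly_Mapping.single i 1) c"

lemma eval_coord [simp]: "eval_multipoly (coord i c) x = c * x ! i"
  by (simp add: coord_def eval_multipoly_single)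

lemma polynomials_in_add:
  "p \<in> polynomials_in n \<Longrightarrow> q \<in> polynomials_in n \<Longrightarrow> p + q \<in> polynomials_in n"
  unfolding polynomials_in_def using Poly_Mapping.keys_add[of p q] by blast

lemma coord_in [simp]: "i < n \<Longrightarrow> coord i c \<in> polynomials_in n"
  by (auto simp: coord_def polynomials_in_def split: if_splits)

definition coord_prod :: "nat \<Rightarrow> nat \<Rightarrow> 'a::comm_ring_1 multipoly" where
  "coord_prod i j = Poly_Mapping.single (Poly_Mapping.single i 1 + Poly_Mapping.single j 1) 1"

lemma eval_coord_prod [simp]:
  assumes "i \<noteq> j"
  shows "eval_multipoly (coord_prod i j) x = x ! i * x ! j"
proof -
  have k: "Poly_Mapping.keys (Poly_Mapping.single i (1::nat) + Poly_Mapping.single j 1) = {i, j}"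
    using assms by (auto simp: in_keys_iff lookup_add lookup_single when_def split: if_splits)
  show ?thesis unfolding coord_prod_def eval_multipoly_single k
    using assms by (simp add: lookup_add lookup_single when_def)
qed

lemma coord_prod_in [simp]:
  assumes "i < n" "j < n" shows "coord_prod i j \<in> polynomials_in n"
proof -
  have "Poly_Mapping.keys (Poly_Mapping.single i (1::nat) + Poly_Mapping.single j 1) \<subseteq> {i, j}"
    by (rule order_trans[OF Poly_Mapping.keys_add]) auto
  then show ?thesis using assms by (auto simp: coord_prod_def polynomials_in_def split: if_splits)
qed

definition index_in :: "'i list \<Rightarrow> 'i \<Rightarrow> nat" where
  "index_in js i = (SOME j. j < length js \<and> js ! j = i)"

lemma index_in:
  assumes "i \<in> set js" shows "index_in js i < length js" "js ! index_in js i = i"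
proof -
  have "\<exists>j. j < length js \<and> js ! j = i" using assms by (auto simp: in_set_conv_nth)
  then have "index_in js i < length js \<and> js ! index_in js i = i"
    unfolding index_in_def by (rule someI_ex)
  then show "index_in js i < length js" "js ! index_in js i = i" by auto
qed

section \<open>Formulas, quantifiers and change of variables\<close>

context o_minimal_structure
begin

lemma affine_in: "affine_space n \<in> S n"
proof (rule algebraic)
  show "algebraic_set n (affine_space n)"
    unfolding algebraic_set_def by (intro exI[of _ "{}"]) auto
qed

lemma zero_set_in: "p \<in> polynomials_in n \<Longrightarrow> {x \<in> affine_space n. eval_multipoly p x = 0} \<in> S n"
  by (rule algebraic, unfold algebraic_set_def, intro exI[of _ "{p}"]) auto

lemma projections: "A \<in> S (n + k) \<Longrightarrow> take n ` A \<in> S n"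
proof (induction k arbitrary: A)
  case 0
  have "take n ` A = A"
    using subsets[OF 0] by (force simp: affine_space_def image_iff)
  then show ?case using 0 by simp
next
  case (Suc k)
  have "take (n + k) ` A \<in> S (n + k)" using Suc.prems by (intro projection) simp
  from Suc.IH[OF this] show ?case by (simp add: image_image)
qed

lemma diagonals_in:
  fixes n :: nat
  assumes "\<And>i. i < n \<Longrightarrow> g i < N" "\<And>i. i < n \<Longrightarrow> h i < N"
  shows "{z \<in> affine_space N. \<forall>i<n. z ! g i = z ! h i} \<in> S N"
proof (rule algebraic)
  let ?P = "(\<lambda>i. coord (g i) (1::'a) + coord (h i) (- 1 :: 'a)) ` {..<n}"
  show "algebraic_set N {z :: 'a list \<in> affine_space N. \<forall>i<n. z ! g i = z ! h i}"
    unfolding algebraic_set_def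
  proof (rule exI[where x = ?P], intro conjI)
    show "?P \<subseteq> polynomials_in N" using assms by (auto intro!: polynomials_in_add)
  qed (auto simp: eval_multipoly_add)
qed

text \<open>Substitution is a projection: cut the product of the \<open>m\<close>-dimensional space
  with \<open>A\<close> by the equations \<open>z ! g i = z ! (m + i)\<close> and forget the last
  \<open>n\<close> coordinates. As \<open>g\<close> is arbitrary, this covers permutations,
  repetitions and dummy variables at once.\<close>

lemma reindex_in:
  assumes A: "A \<in> S n" and g: "\<And>i. i < n \<Longrightarrow> g i < m"
  shows "{x \<in> affine_space m. map (\<lambda>i. x ! g i) [0..<n] \<in> A} \<in> S m" (is "?L \<in> _")
proof -
  let ?Z = "product_set (affine_space m) A \<inter> {z \<in> affine_space (m + n). \<forall>i<n. z ! g i = z ! (m + i)}"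
  have "?Z \<in> S (m + n)"
    using g by (intro intersection product affine_in A diagonals_in) (auto intro: trans_less_add1)
  then have "take m ` ?Z \<in> S m" by (rule projections)
  moreover have "take m ` ?Z = ?L"
  proof (intro equalityI subsetI)
    fix x assume "x \<in> take m ` ?Z"
    then obtain y where y: "length x = m" "y \<in> A" "\<forall>i<n. (x @ y) ! g i = (x @ y) ! (m + i)"
      by (auto simp: product_set_def affine_space_def)
    have ly: "length y = n" using subsets[OF A] y by (auto simp: affine_space_def)
    have "map (\<lambda>i. x ! g i) [0..<n] = y"
      using y ly g by (intro nth_equalityI) (auto simp: nth_append split: if_splits)
    then show "x \<in> ?L" using y by (simp add: affine_space_def)
  next
    fix x assume x: "x \<in> ?L"
    let ?y = "map (\<lambda>i. x ! g i) [0..<n]"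
    have "x @ ?y \<in> ?Z"
      using x g by (auto simp: product_set_def affine_space_def nth_append)
    then show "x \<in> take m ` ?Z"
      using x by (intro image_eqI[of _ _ "x @ ?y"]) (auto simp: affine_space_def)
  qed
  ultimately show ?thesis by simp
qed

text \<open>A formula is a predicate on assignments that reads only the finitely many variables
  listed in \<open>is\<close>. The index type is free, so that a quantifier can bind a fresh
  variable by passing from \<open>'i\<close> to \<open>'i option\<close>.\<close>

definition dfn :: "(('i \<Rightarrow> 'a) \<Rightarrow> bool) \<Rightarrow> bool" where
  "dfn P \<longleftrightarrow> (\<exists>is. \<exists>A \<in> S (length is). \<forall>e. P e \<longleftrightarrow> map e is \<in> A)"

lemma dfnI: "A \<in> S (length is) \<Longrightarrow> (\<And>e. P e \<longleftrightarrow> map e is \<in> A) \<Longrightarrow> dfn P"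
  unfolding dfn_def by blast

text \<open>The list of variables may be traded for any list that contains them; this serves to put
  a bound variable last and to reduce a one-variable formula to a list of length one.\<close>

lemma dfn_normal:
  fixes js :: "'i list" and P :: "('i \<Rightarrow> 'a) \<Rightarrow> bool"
  assumes "A \<in> S (length is)" "\<And>e. P e \<longleftrightarrow> map e is \<in> A" "set is \<subseteq> set js"
  shows "\<exists>A' \<in> S (length js). \<forall>e. P e \<longleftrightarrow> map e js \<in> A'"
proof (intro bexI allI)
  fix e :: "'i \<Rightarrow> 'a"
  let ?A = "{x \<in> affine_space (length js). map (\<lambda>i. x ! index_in js (is ! i)) [0..<length is] \<in> A}"
  show "?A \<in> S (length js)" using assms by (intro reindex_in index_in) auto
  have "map (\<lambda>i. map e js ! index_in js (is ! i)) [0..<length is] = map e is"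
    using assms(3) by (intro nth_equalityI) (auto simp: index_in subset_iff)
  then show "P e \<longleftrightarrow> map e js \<in> ?A" using assms(2) by (simp add: affine_space_def)
qed

text \<open>A variable common to \<open>is\<close> and \<open>js\<close> occurs twice in
  \<open>is @ js\<close>. Both places read the same value of \<open>e\<close>, so the plain product
  set suffices.\<close>

lemma dfn_conj: assumes "dfn P" "dfn Q" shows "dfn (\<lambda>e. P e \<and> Q e)"
proof -
  obtain "is" A where A: "A \<in> S (length is)" "\<And>e. P e \<longleftrightarrow> map e is \<in> A"
    using assms(1) unfolding dfn_def by blast
  obtain js B where B: "B \<in> S (length js)" "\<And>e. Q e \<longleftrightarrow> map e js \<in> B"
    using assms(2) unfolding dfn_def by blast
  show ?thesis
  proof (rule dfnI)
    show "product_set A B \<in> S (length (is @ js))" using product[OF A(1) B(1)] by simp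
    fix e
    have "length x = length is" if "x \<in> A" for x
      using subsets[OF A(1)] that by (auto simp: affine_space_def)
    then show "P e \<and> Q e \<longleftrightarrow> map e (is @ js) \<in> product_set A B"
      by (fastforce simp: A(2) B(2) product_set_def)
  qed
qed

lemma dfn_not: assumes "dfn P" shows "dfn (\<lambda>e. \<not> P e)"
proof -
  obtain "is" A where A: "A \<in> S (length is)" "\<And>e. P e \<longleftrightarrow> map e is \<in> A"
    using assms unfolding dfn_def by blast
  show ?thesis
    by (rule dfnI[OF complement[OF A(1)]]) (auto simp: A(2) affine_space_def)
qed

lemma dfn_disj: "dfn P \<Longrightarrow> dfn Q \<Longrightarrow> dfn (\<lambda>e. P e \<or> Q e)"
  using dfn_not[OF dfn_conj[OF dfn_not[of P] dfn_not[of Q]]] by simp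

lemma dfn_imp: "dfn P \<Longrightarrow> dfn Q \<Longrightarrow> dfn (\<lambda>e. P e \<longrightarrow> Q e)"
  unfolding imp_conv_disj by (intro dfn_disj dfn_not)

lemma dfn_iff: "dfn P \<Longrightarrow> dfn Q \<Longrightarrow> dfn (\<lambda>e. P e = Q e)"
  unfolding iff_conv_conj_imp by (intro dfn_conj dfn_imp)

lemma dfn_rename: assumes "dfn P" shows "dfn (\<lambda>e. P (\<lambda>i. e (f i)))"
proof -
  obtain "is" A where A: "A \<in> S (length is)" "\<And>e. P e \<longleftrightarrow> map e is \<in> A"
    using assms unfolding dfn_def by blast
  show ?thesis
    by (rule dfnI[of A "map f is"]) (use A in \<open>simp_all add: comp_def\<close>)
qed

text \<open>\<open>None\<close> is the bound variable. Once it is listed exactly once and in the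
  last place, the quantifier becomes the projection axiom.\<close>

lemma dfn_ex:
  fixes P :: "('i \<Rightarrow> 'a) \<Rightarrow> 'a \<Rightarrow> bool"
  assumes "dfn (\<lambda>e. P (\<lambda>i. e (Some i)) (e None))"
  shows "dfn (\<lambda>e. \<exists>t. P e t)"
proof -
  obtain "is" A where A: "A \<in> S (length is)"
    "\<And>e. P (\<lambda>i. e (Some i)) (e None) \<longleftrightarrow> map e is \<in> A"
    using assms unfolding dfn_def by blast
  let ?js = "map the (filter (\<lambda>i. i \<noteq> None) is)"
  have "set is \<subseteq> set (map Some ?js @ [None])" by (force simp: image_iff)
  then obtain A' where
    A': "A' \<in> S (length (map Some ?js @ [None]))"
    "\<And>e. P (\<lambda>i. e (Some i)) (e None) \<longleftrightarrow> map e (map Some ?js @ [None]) \<in> A'"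
    using dfn_normal[OF A] by blast
  show ?thesis
  proof (rule dfnI)
    show "take (length ?js) ` A' \<in> S (length ?js)" using A'(1) by (intro projection) simp
    fix e
    have eq: "P e t \<longleftrightarrow> map e ?js @ [t] \<in> A'" for t
      using A'(2)[of "case_option t e"] by (simp add: comp_def)
    have last: "x = take (length ?js) x @ [last x]" if "x \<in> A'" for x
    proof -
      have "length x = Suc (length ?js)" using subsets[OF A'(1)] that by (auto simp: affine_space_def)
      then show ?thesis by (cases x rule: rev_cases) auto
    qed
    show "(\<exists>t. P e t) \<longleftrightarrow> map e ?js \<in> take (length ?js) ` A'"
    proof
      assume "\<exists>t. P e t"
      then obtain t where "map e ?js @ [t] \<in> A'" unfolding eq by blast
      then show "map e ?js \<in> take (length ?js) ` A'" by (rule rev_image_eqI) simp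
    next
      assume "map e ?js \<in> take (length ?js) ` A'"
      then obtain x where "x \<in> A'" "map e ?js = take (length ?js) x" by blast
      then show "\<exists>t. P e t" using last[of x] unfolding eq by metis
    qed
  qed
qed

lemma dfn_all:
  fixes P :: "('i \<Rightarrow> 'a) \<Rightarrow> 'a \<Rightarrow> bool"
  assumes "dfn (\<lambda>e. P (\<lambda>i. e (Some i)) (e None))"
  shows "dfn (\<lambda>e. \<forall>t. P e t)"
  using dfn_not[OF dfn_ex[of "\<lambda>e t. \<not> P e t", OF dfn_not[OF assms]]] by simp

definition dfun :: "(('i \<Rightarrow> 'a) \<Rightarrow> 'a) \<Rightarrow> bool" where
  "dfun f \<longleftrightarrow> dfn (\<lambda>e. e None = f (\<lambda>i. e (Some i)))"

end

text \<open>\<open>P\<close> is a finite set of break points, the only places where membership in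
  \<open>X\<close> can change. This captures finite unions of points and intervals without
  distinguishing kinds of intervals.\<close>

definition tame :: "'a::linorder set \<Rightarrow> bool" where
  "tame X \<longleftrightarrow> (\<exists>P. finite P \<and> (\<forall>a b. a \<le> b \<longrightarrow> {a..b} \<inter> P = {} \<longrightarrow> (a \<in> X \<longleftrightarrow> b \<in> X)))"

lemma tameE:
  assumes "tame X"
  obtains P where "finite P" "\<And>a b. a \<le> b \<Longrightarrow> {a..b} \<inter> P = {} \<Longrightarrow> (a \<in> X \<longleftrightarrow> b \<in> X)"
  using assms unfolding tame_def by metis

lemma tame_Un: assumes "tame X" "tame Y" shows "tame (X \<union> Y)"
proof -
  obtain P where P: "finite P" "\<And>a b. a \<le> b \<Longrightarrow> {a..b} \<inter> P = {} \<Longrightarrow> (a \<in> X \<longleftrightarrow> b \<in> X)"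
    by (rule tameE[OF assms(1)], rule that)
  obtain Q where Q: "finite Q" "\<And>a b. a \<le> b \<Longrightarrow> {a..b} \<inter> Q = {} \<Longrightarrow> (a \<in> Y \<longleftrightarrow> b \<in> Y)"
    by (rule tameE[OF assms(2)], rule that)
  have "a \<in> X \<union> Y \<longleftrightarrow> b \<in> X \<union> Y" if "a \<le> b" "{a..b} \<inter> (P \<union> Q) = {}" for a b
    using P(2)[OF that(1)] Q(2)[OF that(1)] that(2) by blast
  then show ?thesis unfolding tame_def using P(1) Q(1) by (intro exI[of _ "P \<union> Q"]) simp
qed

lemma tame_points_and_intervals:
  fixes X :: "'a::linorder set"
  assumes "X \<in> points_and_intervals" shows "tame X"
proof -
  have "\<exists>a b. \<forall>u v. u \<le> v \<longrightarrow> {u..v} \<inter> {a, b} = {} \<longrightarrow> (u \<in> X \<longleftrightarrow> v \<in> X)"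
    using assms unfolding points_and_intervals_def
  proof (elim UnE)
    assume "X \<in> range (\<lambda>a. {a})"
    then obtain a where "X = {a}" by blast
    then show ?thesis by (intro exI[of _ a]) auto
  next
    assume "X \<in> {{a<..<b} |a b. a < b}"
    then obtain a b where "X = {a<..<b}" by blast
    then show ?thesis by (intro exI[of _ a] exI[of _ b]) auto
  next
    assume "X \<in> range lessThan"
    then obtain a where "X = {..<a}" by blast
    then show ?thesis by (intro exI[of _ a]) auto
  next
    assume "X \<in> range greaterThan"
    then obtain a where "X = {a<..}" by blast
    then show ?thesis by (intro exI[of _ a]) auto
  qed auto
  then obtain a b where "\<forall>u v. u \<le> v \<longrightarrow> {u..v} \<inter> {a, b} = {} \<longrightarrow> (u \<in> X \<longleftrightarrow> v \<in> X)" by blast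
  then show ?thesis unfolding tame_def by (intro exI[of _ "{a, b}"]) auto
qed

lemma tame_Union: "finite C \<Longrightarrow> C \<subseteq> points_and_intervals \<Longrightarrow> tame (\<Union>C)"
proof (induction C rule: finite_induct)
  case empty
  show ?case unfolding tame_def by (intro exI[of _ "{}"]) auto
qed (auto intro: tame_Un tame_points_and_intervals)

lemma finite_gap:
  fixes a :: "'a::linordered_field"
  assumes "finite P" shows "\<exists>\<delta>>0. \<forall>p\<in>P. p \<noteq> a \<longrightarrow> \<delta> \<le> \<bar>p - a\<bar>"
  using assms
proof (induction P rule: finite_induct)
  case empty show ?case by (intro exI[of _ 1]) auto
next
  case (insert x P)
  then obtain \<delta> where "\<delta> > 0" "\<forall>p\<in>P. p \<noteq> a \<longrightarrow> \<delta> \<le> \<bar>p - a\<bar>" by blast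
  then show ?case
    by (intro exI[of _ "if x = a then \<delta> else min \<delta> \<bar>x - a\<bar>"]) (auto simp: min_le_iff_disj)
qed

text \<open>Closer to \<open>a\<close> than any other break point, membership cannot change on the
  right of \<open>a\<close>, so the single test point \<open>a + \<delta> / 2\<close> decides
  it.\<close>

lemma tame_right:
  fixes a :: "'a::linordered_field"
  assumes "tame X"
  shows "\<exists>\<delta>>0. (\<forall>s. a < s \<and> s < a + \<delta> \<longrightarrow> s \<in> X) \<or> (\<forall>s. a < s \<and> s < a + \<delta> \<longrightarrow> s \<notin> X)"
proof -
  obtain P where P: "finite P" "\<And>u v. u \<le> v \<Longrightarrow> {u..v} \<inter> P = {} \<Longrightarrow> (u \<in> X \<longleftrightarrow> v \<in> X)"
    by (rule tameE[OF assms], rule that)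
  obtain \<delta> where \<delta>: "\<delta> > 0" "\<forall>p\<in>P. p \<noteq> a \<longrightarrow> \<delta> \<le> \<bar>p - a\<bar>" using finite_gap[OF P(1)] by blast
  have "u \<in> X \<longleftrightarrow> v \<in> X" if "a < u" "u \<le> v" "v < a + \<delta>" for u v
  proof -
    have "{u..v} \<inter> P = {}" using \<delta> that by force
    then show ?thesis using P(2) that by blast
  qed
  then have eq: "u \<in> X \<longleftrightarrow> v \<in> X" if "a < u" "u < a + \<delta>" "a < v" "v < a + \<delta>" for u v
    using that by (cases "u \<le> v") (blast, metis linear)
  show ?thesis
  proof (cases "a + \<delta> / 2 \<in> X")
    case True
    then have "\<forall>s. a < s \<and> s < a + \<delta> \<longrightarrow> s \<in> X" using eq[of "a + \<delta> / 2"] \<delta>(1) by auto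
    then show ?thesis using \<delta>(1) by blast
  next
    case False
    then have "\<forall>s. a < s \<and> s < a + \<delta> \<longrightarrow> s \<notin> X" using eq[of "a + \<delta> / 2"] \<delta>(1) by auto
    then show ?thesis using \<delta>(1) by blast
  qed
qed

lemma tame_infinite:
  fixes X :: "'a::linordered_field set"
  assumes "tame X" "infinite X" shows "\<exists>a b. a < b \<and> {a<..<b} \<subseteq> X"
proof -
  obtain P where P: "finite P" "\<And>u v. u \<le> v \<Longrightarrow> {u..v} \<inter> P = {} \<Longrightarrow> (u \<in> X \<longleftrightarrow> v \<in> X)"
    by (rule tameE[OF assms(1)], rule that)
  obtain x where x: "x \<in> X" "x \<notin> P" using P(1) assms(2) by (meson finite_subset subsetI)
  obtain \<delta> where \<delta>: "\<delta> > 0" "\<forall>p\<in>P. p \<noteq> x \<longrightarrow> \<delta> \<le> \<bar>p - x\<bar>" using finite_gap[OF P(1)] by blast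
  have "v \<in> X" if "x < v" "v < x + \<delta>" for v
  proof -
    have "{x..v} \<inter> P = {}" using \<delta> that x by (force simp: less_le)
    then show ?thesis using P(2)[of x v] that x by auto
  qed
  then show ?thesis using \<delta>(1) by (intro exI[of _ x] exI[of _ "x + \<delta>"]) auto
qed

text \<open>Replaces Dedekind completeness. Without a maximum, choose \<open>w\<close> in
  \<open>X\<close> beyond every break point that some element of \<open>X\<close> exceeds. The next
  break point after a larger element \<open>w'\<close> is then the supremum: \<open>X\<close>
  continues from \<open>w'\<close> up to it and cannot pass it.\<close>

lemma tame_sup:
  fixes X :: "'a::linordered_field set"
  assumes "tame X" "x \<in> X" "\<And>y. y \<in> X \<Longrightarrow> y \<le> v"
  shows "\<exists>s. (\<forall>y\<in>X. y \<le> s) \<and> (\<forall>u. (\<forall>y\<in>X. y \<le> u) \<longrightarrow> s \<le> u)"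
proof (cases "\<exists>m\<in>X. \<forall>y\<in>X. y \<le> m")
  case True then show ?thesis by blast
next
  case False
  then have nomax: "\<exists>y\<in>X. m < y" if "m \<in> X" for m using that by force
  obtain P where P: "finite P" "\<And>u v. u \<le> v \<Longrightarrow> {u..v} \<inter> P = {} \<Longrightarrow> (u \<in> X \<longleftrightarrow> v \<in> X)"
    by (rule tameE[OF assms(1)], rule that)
  have "\<exists>w\<in>X. \<forall>p\<in>P. (\<exists>y\<in>X. p < y) \<longrightarrow> p < w" using P(1)
  proof (induction P rule: finite_induct)
    case empty then show ?case using assms by blast
  next
    case (insert p P)
    then obtain w where w: "w \<in> X" "\<forall>p\<in>P. (\<exists>y\<in>X. p < y) \<longrightarrow> p < w" by blast
    show ?case
    proof (cases "\<exists>y\<in>X. p < y")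
      case True
      then obtain y where "y \<in> X" "p < y" by blast
      then show ?thesis using w by (intro bexI[of _ "max w y"]) (auto simp: max_def intro: less_trans)
    qed (use w in blast)
  qed
  then obtain w where w: "w \<in> X" and wP: "\<And>p y. p \<in> P \<Longrightarrow> y \<in> X \<Longrightarrow> p < y \<Longrightarrow> p < w" by blast
  obtain w' where w': "w' \<in> X" "w < w'" using nomax w by blast
  let ?Q = "P \<inter> {w'..}"
  \<comment> \<open>Without a break point from \<open>w'\<close> on, \<open>X\<close> would contain
    everything above \<open>w'\<close>, including a point beyond the bound \<open>v\<close>.\<close>
  have "?Q \<noteq> {}"
  proof
    assume "?Q = {}"
    then have "{w'..max w' (v + 1)} \<inter> P = {}" by auto
    then have "max w' (v + 1) \<in> X" using P(2)[of w' "max w' (v + 1)"] w' by auto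
    then show False using assms(3)[of "max w' (v + 1)"] by auto
  qed
  define p where "p = Min ?Q"
  have p: "p \<in> P" "w' \<le> p" "\<And>q. q \<in> P \<Longrightarrow> w' \<le> q \<Longrightarrow> p \<le> q"
    using Min_in[of ?Q] P(1) \<open>?Q \<noteq> {}\<close> unfolding p_def by auto
  have ub: "y \<le> p" if "y \<in> X" for y using wP[OF p(1) that] p(2) w' by force
  have "p \<le> u" if u: "\<forall>y\<in>X. y \<le> u" for u
  proof (rule ccontr)
    assume "\<not> p \<le> u"
    then have up: "u < p" by simp
    define u' where "u' = (u + p) / 2"
    have u': "u < u'" "u' < p" using up by (auto simp: u'_def field_simps)
    have "w' \<le> u'" using u w' u' by fastforce
    moreover have "{w'..u'} \<inter> P = {}" using p(3) u' by fastforce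
    ultimately have "u' \<in> X" using P(2) w' by blast
    then show False using u u' by force
  qed
  then show ?thesis using ub by blast
qed

section \<open>Definable terms, the order, and parameters\<close>

context o_minimal_structure
begin

lemma dfn_const [dfn_intros]: "dfn (\<lambda>e. c)"
proof (cases c)
  case True
  then show ?thesis by (intro dfnI[of "affine_space 0" "[]"]) (auto simp: affine_in, simp add: affine_space_def)
next
  case False
  have "{} \<in> S 0" using complement[OF affine_in[of 0]] by simp
  then show ?thesis using False by (intro dfnI[of "{}" "[]"]) auto
qed

lemma dfn_var_eq: "dfn (\<lambda>e. e i = e j)"
proof (rule dfnI)
  show "{x \<in> affine_space 2. eval_multipoly (coord 0 1 + coord 1 (-1)) x = 0} \<in> S (length [i, j])"
    using zero_set_in[OF polynomials_in_add[OF coord_in coord_in], of 0 2 1 1 "- 1"] by (simp add: numeral_2_eq_2)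
qed (auto simp: eval_multipoly_add affine_space_def)

lemma dfn_var_const: "dfn (\<lambda>e. e i = c)"
proof (rule dfnI)
  have "(\<lambda>t. [t]) ` \<Union>{{c}} \<in> S 1" unfolding dimension_one points_and_intervals_def by blast
  then show "{[c]} \<in> S (length [i])" by simp
qed auto

lemma dfn_var_plus: "dfn (\<lambda>e. e i = e j + e k)"
proof (rule dfnI)
  let ?p = "coord 0 1 + (coord 1 (-1) + coord 2 (-1))"
  show "{x \<in> affine_space 3. eval_multipoly ?p x = 0} \<in> S (length [i, j, k])"
    using zero_set_in[of ?p 3] by (simp add: numeral_3_eq_3 polynomials_in_add)
qed (auto simp: eval_multipoly_add affine_space_def algebra_simps)

lemma dfn_var_times: "dfn (\<lambda>e. e i = e j * e k)"
proof (rule dfnI)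
  let ?p = "coord 0 (-1) + coord_prod 1 2"
  show "{x \<in> affine_space 3. eval_multipoly ?p x = 0} \<in> S (length [i, j, k])"
    using zero_set_in[of ?p 3] by (simp add: numeral_3_eq_3 polynomials_in_add)
qed (auto simp: eval_multipoly_add affine_space_def algebra_simps)

lemma dfun_graph: assumes "dfun f" shows "dfn (\<lambda>e. e j = f (\<lambda>i. e (h i)))"
  using dfn_rename[OF assms[unfolded dfun_def], of "case_option j h"] by simp

lemma dfun_var [dfn_intros]: "dfun (\<lambda>e. e i)"
  unfolding dfun_def by (rule dfn_var_eq)

lemma dfun_const [dfn_intros]: "dfun (\<lambda>e. c)"
  unfolding dfun_def by (rule dfn_var_const)

text \<open>Substituting terms means quantifying over their values and requiring the graphs; the
  slots for the two values are \<open>Some None\<close> and \<open>None\<close>.\<close>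

lemma dfn_subst2:
  assumes "dfn (\<lambda>e::'i option option \<Rightarrow> 'a. R (\<lambda>i. e (Some (Some i))) (e (Some None)) (e None))"
    "dfun f" "dfun g"
  shows "dfn (\<lambda>e. R e (f e) (g e))"
proof -
  have "dfn (\<lambda>e. \<exists>t. \<exists>u. t = f e \<and> u = g e \<and> R e t u)"
    by (intro dfn_ex dfn_conj assms dfun_graph)
  then show ?thesis by simp
qed

lemma dfn_op2:
  assumes "dfn (\<lambda>e::bool \<Rightarrow> 'a. R (e True) (e False))" "dfun f" "dfun g"
  shows "dfn (\<lambda>e. R (f e) (g e))"
  by (rule dfn_subst2[OF _ assms(2,3)])
    (rule dfn_rename[OF assms(1), of "\<lambda>b. if b then Some None else None", simplified])

lemma dfun_rename: "dfun f \<Longrightarrow> dfun (\<lambda>e. f (\<lambda>i. e (h i)))"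
  unfolding dfun_def[of "\<lambda>e. f (\<lambda>i. e (h i))"] by (rule dfun_graph)

lemma dfun_op2:
  assumes "dfn (\<lambda>e::bool option \<Rightarrow> 'a. e None = h (e (Some True)) (e (Some False)))" "dfun f" "dfun g"
  shows "dfun (\<lambda>e. h (f e) (g e))"
  unfolding dfun_def
  by (rule dfn_subst2[of "\<lambda>e t u. e None = h t u", OF _ dfun_rename[OF assms(2)] dfun_rename[OF assms(3)]])
    (rule dfn_rename[OF assms(1), of "case_option (Some (Some None)) (\<lambda>b. if b then Some None else None)", simplified])

lemma dfn_eq [dfn_intros]: "dfun f \<Longrightarrow> dfun g \<Longrightarrow> dfn (\<lambda>e. f e = g e)"
  by (rule dfn_op2[of "\<lambda>x y. x = y"]) (rule dfn_var_eq)

lemma dfun_plus [dfn_intros]: "dfun f \<Longrightarrow> dfun g \<Longrightarrow> dfun (\<lambda>e. f e + g e)"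
  by (rule dfun_op2[of "(+)"]) (rule dfn_var_plus)

lemma dfun_times [dfn_intros]: "dfun f \<Longrightarrow> dfun g \<Longrightarrow> dfun (\<lambda>e. f e * g e)"
  by (rule dfun_op2[of "(*)"]) (rule dfn_var_times)

lemma dfun_minus [dfn_intros]: "dfun f \<Longrightarrow> dfun g \<Longrightarrow> dfun (\<lambda>e. f e - g e)"
proof (rule dfun_op2[of "(-)"])
  have "dfn (\<lambda>e::bool option \<Rightarrow> 'a. e (Some True) = e None + e (Some False))" by (rule dfn_var_plus)
  then show "dfn (\<lambda>e::bool option \<Rightarrow> 'a. e None = e (Some True) - e (Some False))"
    by (simp add: eq_diff_eq eq_commute)
qed

lemmas dfn_connectives [dfn_intros] = dfn_conj dfn_disj dfn_not dfn_imp dfn_iff dfn_ex dfn_all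

lemma dfun_uminus [dfn_intros]: "dfun f \<Longrightarrow> dfun (\<lambda>e. - f e)"
  using dfun_minus[OF dfun_const, of f 0] by simp

lemma dfun_divide [dfn_intros]: "dfun f \<Longrightarrow> dfun g \<Longrightarrow> dfun (\<lambda>e. f e / g e)"
proof (rule dfun_op2[of "(/)"])
  \<comment> \<open>Division by zero yields zero and needs its own clause; elsewhere the quotient is
    described by multiplying out.\<close>
  have "dfn (\<lambda>e::bool option \<Rightarrow> 'a. (e (Some False) = 0 \<and> e None = 0) \<or>
      (e (Some False) \<noteq> 0 \<and> e (Some True) = e None * e (Some False)))" by (intro dfn_intros)
  moreover have "((e (Some False) = 0 \<and> e None = 0) \<or>
      (e (Some False) \<noteq> 0 \<and> e (Some True) = e None * e (Some False))) \<longleftrightarrow>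
      e None = e (Some True) / e (Some False)" for e :: "bool option \<Rightarrow> 'a"
    by (cases "e (Some False) = 0") (auto simp: field_simps)
  ultimately show "dfn (\<lambda>e::bool option \<Rightarrow> 'a. e None = e (Some True) / e (Some False))"
    by simp
qed

text \<open>The order of a real closed field is algebraic: \<open>x < y\<close> means that
  \<open>y - x\<close> is the square of a nonzero element.\<close>

lemma dfn_less [dfn_intros]: "dfun f \<Longrightarrow> dfun g \<Longrightarrow> dfn (\<lambda>e. f e < g e)"
proof (rule dfn_op2[of "(<)"])
  have "dfn (\<lambda>e::bool \<Rightarrow> 'a. \<exists>z. z \<noteq> 0 \<and> e False = e True + z * z)" by (intro dfn_intros)
  moreover have "(\<exists>z. z \<noteq> 0 \<and> y = x + z * z) \<longleftrightarrow> x < y" for x y :: 'a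
  proof
    assume "x < y"
    then obtain z where "y - x = z * z" using nonneg_is_square[of "y - x"] by auto
    then show "\<exists>z. z \<noteq> 0 \<and> y = x + z * z" using \<open>x < y\<close>
      by (intro exI[of _ z]) (auto simp: algebra_simps)
  next
    assume "\<exists>z. z \<noteq> 0 \<and> y = x + z * z"
    then obtain z where "z \<noteq> 0" "y = x + z * z" by blast
    then show "x < y" using zero_less_mult_iff[of z z] by (auto simp: linorder_neq_iff)
  qed
  ultimately show "dfn (\<lambda>e::bool \<Rightarrow> 'a. e True < e False)" by simp
qed

lemma dfn_le [dfn_intros]: "dfun f \<Longrightarrow> dfun g \<Longrightarrow> dfn (\<lambda>e. f e \<le> g e)"
  unfolding le_less by (intro dfn_intros)

lemma dfun_abs [dfn_intros]: "dfun f \<Longrightarrow> dfun (\<lambda>e. \<bar>f e\<bar>)"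
proof -
  assume f: "dfun f"
  have "dfn (\<lambda>e::bool option \<Rightarrow> 'a. (0 \<le> e (Some True) \<and> e None = e (Some True)) \<or>
      (e (Some True) < 0 \<and> e None = - e (Some True)))" by (intro dfn_intros)
  moreover have "((0 \<le> e (Some True) \<and> e None = e (Some True)) \<or>
      (e (Some True) < 0 \<and> e None = - e (Some True))) \<longleftrightarrow> e None = \<bar>e (Some True)\<bar>"
    for e :: "bool option \<Rightarrow> 'a" by auto
  ultimately show ?thesis using dfun_op2[of "\<lambda>x y. \<bar>x\<bar>", OF _ f f] by simp
qed

text \<open>This is what admits parameters. \<open>J\<close> may be infinite, but only its members
  among the finitely many variables read matter, and these are fixed one at a time.\<close>

lemma dfn_fix:
  assumes "dfn P" shows "dfn (\<lambda>e. P (\<lambda>i. if i \<in> J then e0 i else e i))"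
proof -
  obtain "is" A where A: "A \<in> S (length is)" "\<And>e. P e \<longleftrightarrow> map e is \<in> A"
    using assms unfolding dfn_def by blast
  have one: "dfn (\<lambda>e. Q (e(i := c)))" if "dfn Q" for Q :: "('i \<Rightarrow> 'a) \<Rightarrow> bool" and i c
  proof -
    have "dfn (\<lambda>e. \<exists>t. t = c \<and> Q (\<lambda>j. if j = i then t else e j))"
      using dfn_rename[OF that, of "\<lambda>j. if j = i then None else Some j"]
      by (intro dfn_intros) (simp add: if_distrib cong: if_cong)
    then show ?thesis by (simp add: fun_upd_def)
  qed
  have "dfn (\<lambda>e. P (\<lambda>i. if i \<in> set L then e0 i else e i))" for L
  proof (induction L)
    case Nil
    show ?case using assms by simp
  next
    case (Cons k L)
    have "(\<lambda>i. if i \<in> set (k # L) then e0 i else e i) =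
      (\<lambda>i. if i \<in> set L then e0 i else (e(k := e0 k)) i)" for e by auto
    then show ?case using one[OF Cons.IH] by simp
  qed
  from this[of "filter (\<lambda>i. i \<in> J) is"]
  show ?thesis unfolding A(2) by (simp cong: map_cong)
qed

definition dset :: "'a set \<Rightarrow> bool" where
  "dset X \<longleftrightarrow> dfn (\<lambda>e::unit \<Rightarrow> 'a. e () \<in> X)"

definition drel :: "('a \<Rightarrow> 'a \<Rightarrow> bool) \<Rightarrow> bool" where
  "drel R \<longleftrightarrow> dfn (\<lambda>e::bool \<Rightarrow> 'a. R (e True) (e False))"

definition dmap :: "('a \<Rightarrow> 'a) \<Rightarrow> bool" where
  "dmap f \<longleftrightarrow> dfun (\<lambda>e::unit \<Rightarrow> 'a. f (e ()))"

lemma dsetI: "dfn (\<lambda>e::unit \<Rightarrow> 'a. P (e ())) \<Longrightarrow> dset {t. P t}"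
  by (simp add: dset_def)

lemma dfn_mem: "dset X \<Longrightarrow> dfun f \<Longrightarrow> dfn (\<lambda>e. f e \<in> X)"
  unfolding dset_def
  using dfn_op2[of "\<lambda>x y. x \<in> X" f f] dfn_rename[of "\<lambda>e::unit \<Rightarrow> 'a. e () \<in> X" "\<lambda>_. True"] by simp

lemma dfn_drel: "drel R \<Longrightarrow> dfun f \<Longrightarrow> dfun g \<Longrightarrow> dfn (\<lambda>e. R (f e) (g e))"
  unfolding drel_def by (rule dfn_op2)

lemma dfun_dmap: "dmap h \<Longrightarrow> dfun f \<Longrightarrow> dfun (\<lambda>e. h (f e))"
  unfolding dmap_def
  using dfun_op2[of "\<lambda>x y. h x" f f] dfun_graph[of "\<lambda>e::unit \<Rightarrow> 'a. h (e ())" None "\<lambda>_. Some True"] by simp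

text \<open>Brings the o-minimality axiom to bear: brought to the single variable \<open>()\<close>,
  the formula describes a member of \<open>S 1\<close>.\<close>

lemma dset_tame: assumes "dset X" shows "tame X"
proof -
  obtain "is" A where A: "A \<in> S (length is)" "\<And>e::unit \<Rightarrow> 'a. e () \<in> X \<longleftrightarrow> map e is \<in> A"
    using assms unfolding dset_def dfn_def by blast
  obtain A' where A': "A' \<in> S (length [()])" "\<And>e::unit \<Rightarrow> 'a. e () \<in> X \<longleftrightarrow> map e [()] \<in> A'"
    using dfn_normal[of A "is" "\<lambda>e. e () \<in> X" "[()]", OF A] by (auto simp: subset_iff)
  have "A' \<in> S 1" using A'(1) by simp
  then obtain C where C: "finite C" "C \<subseteq> points_and_intervals" "A' = (\<lambda>t. [t]) ` \<Union>C"
    unfolding dimension_one by blast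
  have "X = \<Union>C"
  proof (intro set_eqI)
    fix t
    show "t \<in> X \<longleftrightarrow> t \<in> \<Union>C" using A'(2)[of "\<lambda>_. t"] unfolding C(3) by auto
  qed
  then show ?thesis using tame_Union C by blast
qed

text \<open>The outer variables are frozen at \<open>e0\<close>. The variable \<open>None\<close>
  stays free, so the \<open>undefined\<close> attached to it is never read.\<close>

lemma dset_slice:
  fixes P :: "('i \<Rightarrow> 'a) \<Rightarrow> 'a \<Rightarrow> bool"
  assumes "dfn (\<lambda>e. P (\<lambda>i. e (Some i)) (e None))" shows "dset {t. P e0 t}"
  unfolding dset_def
  using dfn_rename[OF dfn_fix[OF assms, of "range Some" "case_option undefined e0"], of "\<lambda>_. ()"]
  by simp

lemma drel_slice:
  fixes P :: "('i \<Rightarrow> 'a) \<Rightarrow> 'a \<Rightarrow> 'a \<Rightarrow> bool"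
  assumes "dfn (\<lambda>e. P (\<lambda>i. e (Some (Some i))) (e (Some None)) (e None))" shows "drel (P e0)"
proof -
  let ?e0 = "\<lambda>i. case i of Some (Some i) \<Rightarrow> e0 i | _ \<Rightarrow> undefined"
  show ?thesis
    unfolding drel_def
    using dfn_rename[OF dfn_fix[OF assms, of "range (\<lambda>i. Some (Some i))" ?e0],
      of "\<lambda>i. i = Some None"]
    by (simp add: image_iff)
qed

lemma infinite_interval: "dset X \<Longrightarrow> infinite X \<Longrightarrow> \<exists>a b. a < b \<and> {a<..<b} \<subseteq> X"
  using tame_infinite dset_tame by blast

text \<open>Intervals are definably connected. The set \<open>W\<close> of points up to which
  membership agrees with that at \<open>s1\<close> has a supremum, and local constancy there pushes
  \<open>W\<close> beyond it unless it is already \<open>s2\<close>.\<close>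

lemma definable_connected:
  assumes Z: "dset Z" and "s1 \<le> s2"
    and loc: "\<And>s. s1 \<le> s \<Longrightarrow> s \<le> s2 \<Longrightarrow> \<exists>\<delta>>0. \<forall>s'. s1 \<le> s' \<and> s' \<le> s2 \<and> \<bar>s' - s\<bar> < \<delta> \<longrightarrow> (s' \<in> Z \<longleftrightarrow> s \<in> Z)"
  shows "s1 \<in> Z \<longleftrightarrow> s2 \<in> Z"
proof -
  define W where "W = {w. s1 \<le> w \<and> w \<le> s2 \<and> (\<forall>s. s1 \<le> s \<and> s \<le> w \<longrightarrow> (s \<in> Z \<longleftrightarrow> s1 \<in> Z))}"
  have W: "dset W" unfolding W_def by (intro dsetI dfn_intros dfn_mem[OF Z])
  have WD: "s1 \<le> w" "w \<le> s2" "s1 \<le> s \<Longrightarrow> s \<le> w \<Longrightarrow> s \<in> Z \<longleftrightarrow> s1 \<in> Z" if "w \<in> W" for s w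
    using that unfolding W_def by blast+
  have s1: "s1 \<in> W" using \<open>s1 \<le> s2\<close> by (auto simp: W_def)
  have "\<exists>u. (\<forall>w\<in>W. w \<le> u) \<and> (\<forall>v. (\<forall>w\<in>W. w \<le> v) \<longrightarrow> u \<le> v)"
    by (rule tame_sup[OF dset_tame[OF W] s1, of s2]) (simp add: W_def)
  then obtain u where u: "\<And>w. w \<in> W \<Longrightarrow> w \<le> u" "\<And>v. \<forall>w\<in>W. w \<le> v \<Longrightarrow> u \<le> v"
    by metis
  have us: "s1 \<le> u" "u \<le> s2" using u(1)[OF s1] u(2)[of s2] by (auto simp: W_def)
  obtain \<delta> where \<delta>: "\<delta> > 0" "\<And>s'. s1 \<le> s' \<Longrightarrow> s' \<le> s2 \<Longrightarrow> \<bar>s' - u\<bar> < \<delta> \<Longrightarrow> (s' \<in> Z \<longleftrightarrow> u \<in> Z)"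
    using loc[OF us] by blast
  obtain w where w: "w \<in> W" "u - \<delta> < w"
    using u(2)[of "u - \<delta>"] \<delta>(1) by (meson diff_less_eq less_add_same_cancel1 not_less)
  have wu: "w \<le> u" using u w by blast
  define v where "v = min s2 (u + \<delta> / 2)"
  have uZ: "u \<in> Z \<longleftrightarrow> s1 \<in> Z" 
  proof -
    have "\<bar>w - u\<bar> < \<delta>" using w wu \<delta>(1) by simp
    then show ?thesis using \<delta>(2)[of w] WD(1,2)[OF w(1)] WD(3)[OF w(1), of w] by blast
  qed
  have "v \<le> s2" by (simp add: v_def)
  have "v \<in> W"
    unfolding W_def
  proof (intro CollectI conjI allI impI)
    show "s1 \<le> v" and "v \<le> s2" using us \<delta>(1) \<open>s1 \<le> s2\<close> by (auto simp: v_def)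
    fix s assume s: "s1 \<le> s \<and> s \<le> v"
    show "s \<in> Z \<longleftrightarrow> s1 \<in> Z"
    proof (cases "s \<le> w")
      case True then show ?thesis using WD(3)[OF w(1)] s by blast
    next
      case False
      then have "\<bar>s - u\<bar> < \<delta>" using s w \<delta>(1) unfolding v_def by linarith
      then show ?thesis using \<delta>(2)[of s] s uZ \<open>v \<le> s2\<close> by simp
    qed
  qed
  then have "v \<le> u" using u by blast
  then have "v = s2" using \<delta>(1) us by (auto simp: v_def min_def split: if_splits)
  then show ?thesis using WD(3)[OF \<open>v \<in> W\<close>, of s2] \<open>s1 \<le> s2\<close> by simp
qed

end

section \<open>Functions of one variable\<close>

lemma finite_pos_lb:
  fixes f :: "'b \<Rightarrow> 'a::linordered_field"
  assumes "finite Y" "\<And>y. y \<in> Y \<Longrightarrow> 0 < f y"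
  shows "\<exists>\<epsilon>>0. \<forall>y\<in>Y. \<epsilon> \<le> f y"
  using assms
proof (induction Y rule: finite_induct)
  case empty show ?case by (intro exI[of _ 1]) auto
next
  case (insert x Y)
  then obtain \<epsilon> where "\<epsilon> > 0" "\<forall>y\<in>Y. \<epsilon> \<le> f y" by blast
  then show ?case using insert.prems[of x] by (intro exI[of _ "min \<epsilon> (f x)"]) (auto simp: min_le_iff_disj)
qed

context o_minimal_structure
begin

text \<open>Takes the place of a countable union over \<open>c = 1/n\<close>. Suppose every
  \<open>{s. G c s}\<close> is finite, and call a point a record if against each earlier point some
  \<open>c\<close> admits it but not the earlier one. Near the left end of an interval either all
  points are records, and then one \<open>{s. G c s}\<close> contains an interval, or none is, which
  a leftmost point of some \<open>{s. G c s}\<close> refutes.\<close>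

lemma increasing_union_infinite:
  assumes G: "drel G"
    and anti: "\<And>c c' s. G c' s \<Longrightarrow> 0 < c \<Longrightarrow> c \<le> c' \<Longrightarrow> G c s"
    and inf: "infinite {s. \<exists>c>0. G c s}"
  shows "\<exists>c>0. infinite {s. G c s}"
proof (rule ccontr)
  assume "\<not> ?thesis"
  then have fin: "finite {s. G c s}" if "c > 0" for c using that by blast
  have "dset {s. \<exists>c>0. G c s}" by (intro dsetI dfn_intros dfn_drel[OF G])
  from infinite_interval[OF this inf] obtain a b where ab: "a < b" "{a<..<b} \<subseteq> {s. \<exists>c>0. G c s}" by blast
  define R where "R = {y. \<forall>y'. a < y' \<and> y' < y \<longrightarrow> (\<exists>c. 0 < c \<and> G c y \<and> \<not> G c y')}"
  have "dset R" unfolding R_def by (intro dsetI dfn_intros dfn_drel[OF G])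
  from tame_right[OF dset_tame[OF this], of a] obtain \<delta> where \<delta>: "\<delta> > 0"
    "(\<forall>s. a < s \<and> s < a + \<delta> \<longrightarrow> s \<in> R) \<or> (\<forall>s. a < s \<and> s < a + \<delta> \<longrightarrow> s \<notin> R)" by blast
  define d where "d = min \<delta> (b - a)"
  define z where "z = a + d / 2"
  have d: "d > 0" "d \<le> \<delta>" "a + d \<le> b" using \<delta>(1) ab(1) by (auto simp: d_def)
  have z: "a < z" "z < a + d" using d by (auto simp: z_def)
  then have "z \<in> {a<..<b}" using d by auto
  then obtain c where c: "c > 0" "G c z" using ab(2) by blast
  show False using \<delta>(2)
  proof
    assume R: "\<forall>s. a < s \<and> s < a + \<delta> \<longrightarrow> s \<in> R"
    have "{z<..<a + d} \<subseteq> {s. G c s}"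
    proof
      fix y assume y: "y \<in> {z<..<a + d}"
      then have "y \<in> R" using R z d by auto
      then obtain c' where c': "c' > 0" "G c' y" "\<not> G c' z" using z y unfolding R_def by auto
      have "c \<le> c'" using anti[OF c(2) c'(1)] c'(3) by force
      then show "y \<in> {s. G c s}" using anti c c' by blast
    qed
    then show False using fin[OF c(1)] infinite_Ioo[OF z(2)] finite_subset by blast
  next
    assume nR: "\<forall>s. a < s \<and> s < a + \<delta> \<longrightarrow> s \<notin> R"
    define Q where "Q = {s. G c s} \<inter> {a<..<a + d}"
    have Q: "finite Q" "Q \<noteq> {}" using fin[OF c(1)] c z unfolding Q_def by auto
    \<comment> \<open>The leftmost point is a record: the same \<open>c\<close> works against every
      earlier point.\<close>
    define y where "y = Min Q"
    have y: "y \<in> Q" "\<And>q. q \<in> Q \<Longrightarrow> y \<le> q" using Q unfolding y_def by auto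
    have "y \<in> R" unfolding R_def
    proof (intro CollectI allI impI)
      fix y' assume y': "a < y' \<and> y' < y"
      then have "y' \<notin> Q" using y(2) by force
      then have "\<not> G c y'" using y' y(1) unfolding Q_def by auto
      then show "\<exists>c. 0 < c \<and> G c y \<and> \<not> G c y'" using c(1) y(1) unfolding Q_def by blast
    qed
    then show False using nR y(1) d unfolding Q_def by auto
  qed
qed

definition jump_up :: "('a \<Rightarrow> 'a) \<Rightarrow> 'a \<Rightarrow> 'a \<Rightarrow> bool" where
  "jump_up f c s \<longleftrightarrow> (\<exists>\<delta>>0. \<forall>s'. s < s' \<and> s' < s + \<delta> \<longrightarrow> f s + c \<le> f s')"

text \<open>Otherwise jumps of one size \<open>c\<close> occur throughout an interval, and no
  subinterval keeps \<open>f\<close> in a band \<open>[u, u + c)\<close>. Hence the set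
  \<open>W\<close> of levels below which \<open>f\<close> stays on no subinterval is closed under
  adding \<open>c\<close>. As \<open>f\<close> is bounded, \<open>W\<close> has a supremum, which
  contradicts the shift; this stands in for an Archimedean count of jumps.\<close>

lemma jump_up_finite:
  assumes f: "dmap f" and bd: "\<And>s. \<bar>f s\<bar> \<le> 1"
  shows "finite {s. \<exists>c>0. jump_up f c s}"
proof (rule ccontr)
  assume inf: "infinite {s. \<exists>c>0. jump_up f c s}"
  have J: "drel (jump_up f)" unfolding drel_def jump_up_def by (intro dfn_intros dfun_dmap[OF f])
  have "\<exists>c>0. infinite {s. jump_up f c s}"
  proof (rule increasing_union_infinite[OF J _ inf])
    fix c c' s assume "jump_up f c' s" "0 < c" "c \<le> c'"
    then show "jump_up f c s" unfolding jump_up_def by (meson add_left_mono order_trans)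
  qed
  then obtain c where c: "c > 0" "infinite {s. jump_up f c s}" by blast
  have "dset {s. jump_up f c s}" by (intro dsetI dfn_drel[OF J] dfn_intros)
  from infinite_interval[OF this c(2)] obtain p q where pq: "p < q" "\<And>s. p < s \<Longrightarrow> s < q \<Longrightarrow> jump_up f c s"
    by (metis greaterThanLessThan_iff mem_Collect_eq subsetD)
  \<comment> \<open>The midpoint of the subinterval lies in the band, and its jump leads out of the
    band at points still inside the subinterval.\<close>
  have T: False if pq': "p' < q'" and H: "\<And>s. p' < s \<Longrightarrow> s < q' \<Longrightarrow> p < s \<and> s < q \<and> u \<le> f s \<and> f s < u + c" for u p' q'
  proof -
    define s where "s = (p' + q') / 2"
    have s: "p' < s" "s < q'" using pq' by (auto simp: s_def field_simps)
    obtain \<delta> where \<delta>: "\<delta> > 0" "\<And>s'. s < s' \<Longrightarrow> s' < s + \<delta> \<Longrightarrow> f s + c \<le> f s'"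
      using pq(2)[of s] H[OF s] unfolding jump_up_def by blast
    define s' where "s' = s + min (\<delta> / 2) ((q' - s) / 2)"
    have "s < s'" "s' < s + \<delta>" "s' < q'" using \<delta>(1) s by (auto simp: s'_def min_def field_simps)
    then show False using \<delta>(2)[of s'] H[of s'] H[OF s] s by force
  qed
  define W where "W = {u. \<forall>p' q'. p' < q' \<longrightarrow> \<not> (\<forall>s. p' < s \<and> s < q' \<longrightarrow> p < s \<and> s < q \<and> f s < u)}"
  have W: "dset W" unfolding W_def by (intro dsetI dfn_intros dfun_dmap[OF f])
  have step: "u + c \<in> W" if u: "u \<in> W" for u
    unfolding W_def
  proof (intro CollectI allI impI notI)
    fix p' q' assume p'q': "p' < q'" and H: "\<forall>s. p' < s \<and> s < q' \<longrightarrow> p < s \<and> s < q \<and> f s < u + c"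
    have d1: "dset {s. p' < s \<and> s < q' \<and> u \<le> f s}" and d2: "dset {s. p' < s \<and> s < q' \<and> f s < u}"
      by (intro dsetI dfn_intros dfun_dmap[OF f])+
    \<comment> \<open>One of the two pieces contains an interval: \<open>T\<close> rules this out
      for the upper piece, \<open>u \<in> W\<close> for the lower one.\<close>
    have "{p'<..<q'} = {s. p' < s \<and> s < q' \<and> u \<le> f s} \<union> {s. p' < s \<and> s < q' \<and> f s < u}" by auto
    then have "infinite {s. p' < s \<and> s < q' \<and> u \<le> f s} \<or> infinite {s. p' < s \<and> s < q' \<and> f s < u}"
      using infinite_Ioo[OF p'q'] by (metis finite_UnI)
    then show False
    proof
      assume "infinite {s. p' < s \<and> s < q' \<and> u \<le> f s}"
      from infinite_interval[OF d1 this] obtain a b where "a < b" "{a<..<b} \<subseteq> {s. p' < s \<and> s < q' \<and> u \<le> f s}" by blast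
      then show False using T[of a b u] H by force
    next
      assume "infinite {s. p' < s \<and> s < q' \<and> f s < u}"
      from infinite_interval[OF d2 this] obtain a b where "a < b" "{a<..<b} \<subseteq> {s. p' < s \<and> s < q' \<and> f s < u}" by blast
      then show False using u H unfolding W_def by force
    qed
  qed
  have m2: "-2 \<in> W"
    unfolding W_def
  proof (intro CollectI allI impI notI)
    fix p' q' assume "p' < q'" and H: "\<forall>s. p' < s \<and> s < q' \<longrightarrow> p < s \<and> s < q \<and> f s < -2"
    then have "f ((p' + q') / 2) < -2" by (simp add: field_simps)
    then show False using bd[of "(p' + q') / 2"] by linarith
  qed
  have ub: "u \<le> 1" if "u \<in> W" for u
  proof (rule ccontr)
    assume "\<not> u \<le> 1"
    then have "f s < u" for s using bd[of s] by linarith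
    then show False using that pq(1) unfolding W_def by blast
  qed
  have "\<exists>w. (\<forall>y\<in>W. y \<le> w) \<and> (\<forall>u. (\<forall>y\<in>W. y \<le> u) \<longrightarrow> w \<le> u)"
    by (rule tame_sup[OF dset_tame[OF W] m2 ub])
  then obtain w where w: "\<forall>y\<in>W. y \<le> w" "\<forall>u. (\<forall>y\<in>W. y \<le> u) \<longrightarrow> w \<le> u" by blast
  have "\<forall>y\<in>W. y \<le> w - c" using w(1) step by force
  then show False using w(2) c(1) by force
qed

definition cont_at :: "('a \<Rightarrow> 'a) \<Rightarrow> 'a \<Rightarrow> bool" where
  "cont_at f s \<longleftrightarrow> (\<forall>\<epsilon>>0. \<exists>\<delta>>0. \<forall>s'. \<bar>s' - s\<bar> < \<delta> \<longrightarrow> \<bar>f s' - f s\<bar> < \<epsilon>)"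

text \<open>By tameness the values just to the right of \<open>s\<close> either all reach
  \<open>f s + \<epsilon>\<close>, which is a jump, or all stay below it; the same holds for the
  negated function.\<close>

lemma no_jump_right:
  assumes f: "dmap f" and j: "\<not> (\<exists>c>0. jump_up f c s)" "\<not> (\<exists>c>0. jump_up (\<lambda>s. - f s) c s)" and \<epsilon>: "\<epsilon> > 0"
  shows "\<exists>\<delta>>0. \<forall>s'. s < s' \<and> s' < s + \<delta> \<longrightarrow> \<bar>f s' - f s\<bar> < \<epsilon>"
proof -
  have d: "dset {s'. f s + \<epsilon> \<le> f s'}" "dset {s'. - f s + \<epsilon> \<le> - f s'}"
    by (intro dsetI dfn_intros dfun_dmap[OF f])+
  obtain \<delta>1 where 1: "\<delta>1 > 0" "\<forall>s'. s < s' \<and> s' < s + \<delta>1 \<longrightarrow> s' \<notin> {s'. f s + \<epsilon> \<le> f s'}"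
    using tame_right[OF dset_tame[OF d(1)], of s] j(1) \<epsilon> unfolding jump_up_def by blast
  obtain \<delta>2 where 2: "\<delta>2 > 0" "\<forall>s'. s < s' \<and> s' < s + \<delta>2 \<longrightarrow> s' \<notin> {s'. - f s + \<epsilon> \<le> - f s'}"
    using tame_right[OF dset_tame[OF d(2)], of s] j(2) \<epsilon> unfolding jump_up_def by blast
  have "\<bar>f s' - f s\<bar> < \<epsilon>" if "s < s' \<and> s' < s + min \<delta>1 \<delta>2" for s'
  proof -
    have "s' \<notin> {s'. f s + \<epsilon> \<le> f s'}" "s' \<notin> {s'. - f s + \<epsilon> \<le> - f s'}" using 1(2) 2(2) that by auto
    then show ?thesis unfolding abs_less_iff mem_Collect_eq by linarith
  qed
  then show ?thesis using 1 2 by (intro exI[of _ "min \<delta>1 \<delta>2"]) auto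
qed

text \<open>A discontinuity comes from a jump up or down, on the right or on the left; changing the
  sign of \<open>f\<close> and of its argument reduces all four kinds to jumps up on the
  right.\<close>

lemma discontinuities_finite:
  assumes f: "dmap f" and bd: "\<And>s. \<bar>f s\<bar> \<le> 1"
  shows "finite {s. \<not> cont_at f s}"
proof -
  define J where "J g = {s. \<exists>c>0. jump_up g c s}" for g :: "'a \<Rightarrow> 'a"
  have dm: "dmap (\<lambda>s. - f s)" "dmap (\<lambda>s. f (- s))" "dmap (\<lambda>s. - f (- s))"
    unfolding dmap_def by (intro dfn_intros dfun_dmap[OF f])+
  have fin: "finite (J f)" "finite (J (\<lambda>s. - f s))" "finite (J (\<lambda>s. f (- s)))" "finite (J (\<lambda>s. - f (- s)))"
    unfolding J_def by (intro jump_up_finite f dm; simp add: bd)+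
  have "{s. \<not> cont_at f s} \<subseteq> J f \<union> J (\<lambda>s. - f s) \<union> uminus ` (J (\<lambda>s. f (- s)) \<union> J (\<lambda>s. - f (- s)))"
  proof (rule ccontr)
    assume "\<not> ?thesis"
    then obtain s where s: "\<not> cont_at f s" "s \<notin> J f" "s \<notin> J (\<lambda>s. - f s)"
      "s \<notin> uminus ` J (\<lambda>s. f (- s))" "s \<notin> uminus ` J (\<lambda>s. - f (- s))" by blast
    have s': "- s \<notin> J (\<lambda>s. f (- s))" "- s \<notin> J (\<lambda>s. - f (- s))"
      using s(4,5) by (metis image_eqI minus_minus)+
    have "cont_at f s" unfolding cont_at_def
    proof (intro allI impI)
      fix \<epsilon> :: 'a assume \<epsilon>: "\<epsilon> > 0"
      obtain \<delta>1 where 1: "\<delta>1 > 0" "\<forall>s'. s < s' \<and> s' < s + \<delta>1 \<longrightarrow> \<bar>f s' - f s\<bar> < \<epsilon>"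
        using no_jump_right[OF f _ _ \<epsilon>, of s] s unfolding J_def by blast
      obtain \<delta>2 where 2: "\<delta>2 > 0" "\<forall>s'. - s < s' \<and> s' < - s + \<delta>2 \<longrightarrow> \<bar>f (- s') - f (- (- s))\<bar> < \<epsilon>"
        using no_jump_right[OF dm(2) _ _ \<epsilon>, of "- s"] s' unfolding J_def by blast
      have "\<bar>f s' - f s\<bar> < \<epsilon>" if "\<bar>s' - s\<bar> < min \<delta>1 \<delta>2" for s'
      proof -
        consider "s < s'" | "s' < s" | "s' = s" by fastforce
        then show ?thesis
        proof cases
          case 1 then show ?thesis using \<open>\<forall>s'. s < s' \<and> s' < s + \<delta>1 \<longrightarrow> _\<close> that by auto
        next
          case 2
          have "- s < - s'" "- s' < - s + \<delta>2" using 2 that by auto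
          then show ?thesis using \<open>\<forall>s'. - s < s' \<and> s' < - s + \<delta>2 \<longrightarrow> _\<close> by force
        qed (use \<epsilon> in simp)
      qed
      then show "\<exists>\<delta>>0. \<forall>s'. \<bar>s' - s\<bar> < \<delta> \<longrightarrow> \<bar>f s' - f s\<bar> < \<epsilon>"
        using 1 2 by (intro exI[of _ "min \<delta>1 \<delta>2"]) auto
    qed
    then show False using s by blast
  qed
  then show ?thesis using fin by (meson finite_UnI finite_imageI finite_subset)
qed

lemma dmapI: "drel (\<lambda>t s. t = f s) \<Longrightarrow> dmap f"
  unfolding drel_def dmap_def dfun_def
  using dfn_rename[of "\<lambda>e::bool \<Rightarrow> 'a. e True = f (e False)" "\<lambda>b. if b then None else Some ()"] by simp

text \<open>The choice has to be made by a formula: the least element of the fibre if there is one,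
  otherwise the midpoint of the maximal interval \<open>(a, b)\<close> with which the fibre starts
  at its infimum \<open>a\<close>. The bound \<open>1\<close> ensures that \<open>a\<close> and
  \<open>b\<close> exist in the field.\<close>

lemma definable_choice:
  assumes H: "drel H" and J: "dset J" and ne: "\<And>s. s \<in> J \<Longrightarrow> \<exists>y. \<bar>y\<bar> \<le> 1 \<and> H s y"
  shows "\<exists>f. dmap f \<and> (\<forall>s. \<bar>f s\<bar> \<le> 1) \<and> (\<forall>s\<in>J. H s (f s))"
proof -
  define X where "X s y \<longleftrightarrow> \<bar>y\<bar> \<le> 1 \<and> H s y" for s y
  have X: "drel X" unfolding X_def drel_def by (intro dfn_intros dfn_drel[OF H])
  define low where "low s y \<longleftrightarrow> X s y \<and> (\<forall>z. X s z \<longrightarrow> y \<le> z)" for s y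
  define inf where "inf s a \<longleftrightarrow> (\<forall>z. X s z \<longrightarrow> a \<le> z) \<and> (\<forall>a'. (\<forall>z. X s z \<longrightarrow> a' \<le> z) \<longrightarrow> a' \<le> a)" for s a
  define top where "top s a b \<longleftrightarrow> a < b \<and> (\<forall>z. a < z \<and> z < b \<longrightarrow> X s z) \<and>
    (\<forall>b'. (\<forall>z. a < z \<and> z < b' \<longrightarrow> X s z) \<longrightarrow> b' \<le> b)" for s a b
  define Pk where "Pk s y \<longleftrightarrow> ((\<exists>m. low s m) \<and> low s y) \<or>
    (\<not> (\<exists>m. low s m) \<and> (\<exists>a b. inf s a \<and> top s a b \<and> y = (a + b) / 2))" for s y
  have uniq: "y = y'" if "Pk s y" "Pk s y'" for s y y'
  proof (cases "\<exists>m. low s m")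
    case True
    then show ?thesis using that unfolding Pk_def low_def by (metis order_antisym)
  next
    case False
    have "\<exists>a b. inf s a \<and> top s a b \<and> y = (a + b) / 2" "\<exists>a b. inf s a \<and> top s a b \<and> y' = (a + b) / 2"
      using that False unfolding Pk_def by simp_all
    then obtain a b a' b' where *: "inf s a" "top s a b" "y = (a + b) / 2" "inf s a'" "top s a' b'" "y' = (a' + b') / 2"
      by metis
    then have "a = a'" unfolding inf_def by (meson order_antisym)
    moreover from this have "b = b'" using * unfolding top_def by (meson order_antisym)
    ultimately show ?thesis using * by simp
  qed
  have ex: "\<exists>y. Pk s y" if s: "s \<in> J" for s
  proof (cases "\<exists>m. low s m")
    case True then show ?thesis unfolding Pk_def by blast
  next
    case False
    obtain x where x: "X s x" using ne[OF s] unfolding X_def by blast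
    have dX: "dset {y. X s y}" by (intro dsetI dfn_drel[OF X] dfn_intros)
    define L where "L = {a. \<forall>z. X s z \<longrightarrow> a \<le> z}"
    have L: "dset L" unfolding L_def by (intro dsetI dfn_intros dfn_drel[OF X])
    have m1: "-1 \<in> L" unfolding L_def X_def by auto
    have "\<exists>a. (\<forall>y\<in>L. y \<le> a) \<and> (\<forall>u. (\<forall>y\<in>L. y \<le> u) \<longrightarrow> a \<le> u)"
      by (rule tame_sup[OF dset_tame[OF L] m1, of x]) (use x in \<open>auto simp: L_def\<close>)
    then obtain a where a: "\<forall>y\<in>L. y \<le> a" "\<forall>u. (\<forall>y\<in>L. y \<le> u) \<longrightarrow> a \<le> u" by blast
    have aL: "a \<le> z" if "X s z" for z using a(2) that unfolding L_def by blast
    have inf: "inf s a" using aL a(1) unfolding inf_def L_def by blast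
    have na: "\<not> X s a" using False aL unfolding low_def by blast
    obtain \<delta> where \<delta>: "\<delta> > 0" "(\<forall>z. a < z \<and> z < a + \<delta> \<longrightarrow> X s z) \<or> (\<forall>z. a < z \<and> z < a + \<delta> \<longrightarrow> \<not> X s z)"
      using tame_right[OF dset_tame[OF dX], of a] by auto
    \<comment> \<open>If the fibre missed a right neighbourhood of its infimum \<open>a\<close>,
      which it does not contain, then \<open>a + \<delta>\<close> would still be a lower
      bound.\<close>
    have "\<forall>z. a < z \<and> z < a + \<delta> \<longrightarrow> X s z"
    proof (rule ccontr)
      assume "\<not> ?thesis"
      then have out: "\<forall>z. a < z \<and> z < a + \<delta> \<longrightarrow> \<not> X s z" using \<delta>(2) by blast
      have "a + \<delta> \<in> L" unfolding L_def
      proof (intro CollectI allI impI)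
        fix z assume z: "X s z"
        then have "a < z" using aL[OF z] na by (cases "z = a") auto
        then show "a + \<delta> \<le> z" using out z by force
      qed
      then show False using a(1) \<delta>(1) by force
    qed
    then have mB: "a + \<delta> \<in> {b. \<forall>z. a < z \<and> z < b \<longrightarrow> X s z}" (is "_ \<in> ?B") by blast
    have B: "dset ?B" by (intro dsetI dfn_intros dfn_drel[OF X])
    have "\<exists>b. (\<forall>y\<in>?B. y \<le> b) \<and> (\<forall>u. (\<forall>y\<in>?B. y \<le> u) \<longrightarrow> b \<le> u)"
    \<comment> \<open>A larger \<open>b\<close> would put \<open>max (a + 1 / 2) 2\<close> into
      \<open>(a, b)\<close> and hence into the fibre, which lies in \<open>[-1, 1]\<close>.\<close>
    proof (rule tame_sup[OF dset_tame[OF B] mB, of "max (a + 1) 3"])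
      fix b assume b: "b \<in> ?B"
      show "b \<le> max (a + 1) 3"
      proof (rule ccontr)
        assume "\<not> ?thesis"
        then have "a + 1 < b" "3 < b" by auto
        moreover have "a < max (a + 1 / 2) 2" by (simp add: less_max_iff_disj)
        moreover have "max (a + 1 / 2) 2 < b" using \<open>a + 1 < b\<close> \<open>3 < b\<close> by (simp add: add.commute)
        ultimately have "X s (max (a + 1 / 2) 2)" using b by blast
        then show False unfolding X_def by (auto simp: abs_le_iff)
      qed
    qed
    then obtain b where b: "\<forall>y\<in>?B. y \<le> b" "\<forall>u. (\<forall>y\<in>?B. y \<le> u) \<longrightarrow> b \<le> u" by blast
    have "X s z" if "a < z" "z < b" for z
    proof (rule ccontr)
      assume "\<not> X s z"
      then have "\<forall>y\<in>?B. y \<le> z" using that(1) by force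
      then show False using b(2) that by force
    qed
    moreover have "a < b" using b(1) mB \<delta>(1) by force
    ultimately have "top s a b" using b(1) unfolding top_def by blast
    then show ?thesis using False inf unfolding Pk_def by blast
  qed
  define f where "f s = (if s \<in> J then THE y. Pk s y else 0)" for s
  have Pf: "Pk s y \<longleftrightarrow> y = f s" if "s \<in> J" for s y
  proof -
    have "Pk s (THE y. Pk s y)" using ex[OF that] uniq by (metis theI)
    then show ?thesis using uniq that unfolding f_def by auto
  qed
  have PX: "X s y" if "Pk s y" for s y
    using that unfolding Pk_def low_def top_def by (auto simp: field_simps)
  have "dmap f"
  proof (rule dmapI)
    have "dfn (\<lambda>e::bool \<Rightarrow> 'a. (e False \<in> J \<and> Pk (e False) (e True)) \<or> (e False \<notin> J \<and> e True = 0))"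
      unfolding Pk_def low_def inf_def top_def
      by (intro dfn_intros dfn_drel[OF X] dfn_mem[OF J])
    moreover have "(s \<in> J \<and> Pk s t) \<or> (s \<notin> J \<and> t = 0) \<longleftrightarrow> t = f s" for s t
      using Pf[of s t] by (cases "s \<in> J") (auto simp: f_def)
    ultimately show "drel (\<lambda>t s. t = f s)" unfolding drel_def by simp
  qed
  moreover have "\<forall>s\<in>J. X s (f s)" using PX Pf by blast
  ultimately show ?thesis unfolding X_def by (intro exI[of _ f]) (auto simp: f_def)
qed

end

section \<open>Uniform finiteness\<close>

context o_minimal_structure
begin

text \<open>Either \<open>A\<close> misses a box around the point, or near it \<open>A\<close> is a
  single continuous branch through it. Points off \<open>A\<close> are judged too: for them only the
  empty box remains, which excludes branches that approach \<open>y\<close> without reaching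
  it.\<close>

definition regular_at :: "('a \<Rightarrow> 'a \<Rightarrow> bool) \<Rightarrow> 'a \<Rightarrow> 'a \<Rightarrow> bool" where
  "regular_at A s y \<longleftrightarrow>
    (\<exists>\<epsilon>>0. \<exists>\<delta>>0. \<forall>s' y'. \<bar>s' - s\<bar> < \<delta> \<and> \<bar>y' - y\<bar> < \<epsilon> \<longrightarrow> \<not> A s' y') \<or>
    (A s y \<and> (\<exists>\<epsilon>0>0. \<forall>\<epsilon>. 0 < \<epsilon> \<and> \<epsilon> \<le> \<epsilon>0 \<longrightarrow> (\<exists>\<delta>>0. \<forall>s'. \<bar>s' - s\<bar> < \<delta> \<longrightarrow>
      (\<exists>y'. A s' y' \<and> \<bar>y' - y\<bar> < \<epsilon> \<and> (\<forall>y''. A s' y'' \<and> \<bar>y'' - y\<bar> < \<epsilon> \<longrightarrow> y'' = y')))))"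

definition critical :: "('a \<Rightarrow> 'a \<Rightarrow> bool) \<Rightarrow> 'a \<Rightarrow> bool" where
  "critical A s \<longleftrightarrow> (\<exists>y. \<bar>y\<bar> \<le> 1 \<and> \<not> regular_at A s y)"

text \<open>Choose definably an irregular point \<open>f s\<close> over each critical
  \<open>s\<close>. If there are infinitely many, then on some interval \<open>f\<close> is
  continuous, the rest of the fibre keeps a fixed distance \<open>c\<close> from \<open>f s\<close>,
  and \<open>A s (f s)\<close> has a fixed truth value. Near the graph of \<open>f\<close> the
  relation \<open>A\<close> is then that graph or empty, so the chosen points are regular after
  all.\<close>

lemma critical_finite:
  assumes A: "drel A" and fin: "\<And>s. finite {y. A s y}"
  shows "finite {s. critical A s}"
proof (rule ccontr)
  assume inf: "infinite {s. critical A s}"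
  have reg: "drel (\<lambda>s y. \<not> regular_at A s y)"
    unfolding regular_at_def drel_def by (intro dfn_intros dfn_drel[OF A])
  have J: "dset {s. critical A s}"
    unfolding critical_def by (intro dsetI dfn_intros dfn_drel[OF reg])
  have "\<exists>f. dmap f \<and> (\<forall>s. \<bar>f s\<bar> \<le> 1) \<and> (\<forall>s\<in>{s. critical A s}. \<not> regular_at A s (f s))"
    by (rule definable_choice[OF reg J]) (simp add: critical_def)
  then obtain f where f: "dmap f" "\<And>s. \<bar>f s\<bar> \<le> 1" "\<And>s. critical A s \<Longrightarrow> \<not> regular_at A s (f s)"
    by blast
  \<comment> \<open>A finite fibre satisfies this for some positive \<open>c\<close>, and the
    condition weakens as \<open>c\<close> shrinks, which is the form that
    \<open>increasing_union_infinite\<close> takes.\<close>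
  define G where "G c s \<longleftrightarrow> critical A s \<and> (\<forall>y'. A s y' \<and> y' \<noteq> f s \<longrightarrow> c \<le> \<bar>y' - f s\<bar>)" for c s
  have G: "drel G" unfolding G_def critical_def drel_def
    by (intro dfn_intros dfn_drel[OF reg] dfn_drel[OF A] dfun_dmap[OF f(1)])
  have "\<exists>c>0. G c s" if "critical A s" for s
    using finite_gap[OF fin, of s "f s"] that unfolding G_def by blast
  then have "{s. \<exists>c>0. G c s} = {s. critical A s}" unfolding G_def by blast
  then have inf': "infinite {s. \<exists>c>0. G c s}" using inf by simp
  have "\<exists>c>0. infinite {s. G c s}"
    by (rule increasing_union_infinite[OF G _ inf']) (auto simp: G_def intro: order_trans)
  then obtain c where c: "c > 0" "infinite {s. G c s}" by blast
  have contf: "drel (\<lambda>_ s. cont_at f s)" unfolding cont_at_def drel_def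
    by (intro dfn_intros dfun_dmap[OF f(1)])
  define K where "K b = {s. G c s \<and> cont_at f s \<and> (A s (f s) \<longleftrightarrow> b)}" for b
  have K: "dset (K b)" for b unfolding K_def
    by (intro dsetI dfn_intros dfn_drel[OF G] dfn_drel[OF contf, of "\<lambda>e. 0"] dfn_drel[OF A] dfun_dmap[OF f(1)])
  have "{s. G c s} \<subseteq> {s. \<not> cont_at f s} \<union> K True \<union> K False" unfolding K_def by auto
  then have "\<exists>b. infinite (K b)"
    using c(2) discontinuities_finite[OF f(1,2)] by (meson finite_UnI finite_subset)
  then obtain b where "infinite (K b)" by blast
  from infinite_interval[OF K this] obtain p q where "p < q" "{p<..<q} \<subseteq> K b" by blast
  then have pq: "p < q" "\<And>s. p < s \<Longrightarrow> s < q \<Longrightarrow> s \<in> K b" by auto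
  define s0 where "s0 = (p + q) / 2"
  define r where "r = (q - p) / 2"
  have r: "r > 0" using pq by (simp add: r_def)
  have near: "s \<in> K b" if "\<bar>s - s0\<bar> < r" for s
  proof (rule pq(2))
    have "s0 - r = p" "s0 + r = q" by (simp_all add: s0_def r_def field_simps)
    then show "p < s" "s < q" using that by linarith+
  qed
  have s0: "s0 \<in> K b" using near[of s0] r by simp
  have cont: "\<exists>\<delta>>0. \<forall>s. \<bar>s - s0\<bar> < \<delta> \<longrightarrow> \<bar>f s - f s0\<bar> < \<epsilon> \<and> s \<in> K b" if \<epsilon>: "\<epsilon> > 0" for \<epsilon>
  proof -
    obtain \<delta> where "\<delta> > 0" "\<forall>s. \<bar>s - s0\<bar> < \<delta> \<longrightarrow> \<bar>f s - f s0\<bar> < \<epsilon>"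
      using s0 \<epsilon> unfolding K_def cont_at_def by blast
    then show ?thesis using near r by (intro exI[of _ "min \<delta> r"]) auto
  qed
  have gap: "y = f s" if "s \<in> K b" "A s y" "\<bar>y - f s\<bar> < c" for s y
    using that unfolding K_def G_def by force
  have "regular_at A s0 (f s0)"
  proof (cases b)
    case True
    have "\<exists>\<delta>>0. \<forall>s'. \<bar>s' - s0\<bar> < \<delta> \<longrightarrow>
        (\<exists>y'. A s' y' \<and> \<bar>y' - f s0\<bar> < \<epsilon> \<and> (\<forall>y''. A s' y'' \<and> \<bar>y'' - f s0\<bar> < \<epsilon> \<longrightarrow> y'' = y'))"
      if \<epsilon>: "0 < \<epsilon> \<and> \<epsilon> \<le> c / 2" for \<epsilon>
    proof -
      obtain \<delta> where \<delta>: "\<delta> > 0" "\<And>s. \<bar>s - s0\<bar> < \<delta> \<Longrightarrow> \<bar>f s - f s0\<bar> < \<epsilon> \<and> s \<in> K b"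
        using cont \<epsilon> by blast
      have "A s (f s) \<and> \<bar>f s - f s0\<bar> < \<epsilon> \<and> (\<forall>y''. A s y'' \<and> \<bar>y'' - f s0\<bar> < \<epsilon> \<longrightarrow> y'' = f s)"
        if s: "\<bar>s - s0\<bar> < \<delta>" for s
      proof (intro conjI allI impI)
        show "A s (f s)" using \<delta>(2)[OF s] True unfolding K_def by simp
        show "\<bar>f s - f s0\<bar> < \<epsilon>" using \<delta>(2)[OF s] by simp
        fix y assume y: "A s y \<and> \<bar>y - f s0\<bar> < \<epsilon>"
        \<comment> \<open>Both points lie within \<open>\<epsilon> \<le> c / 2\<close> of
          \<open>f s0\<close>, and no other point of the fibre is closer to \<open>f s\<close> than
          \<open>c\<close>.\<close>
        have "\<bar>y - f s\<bar> < \<epsilon> + \<epsilon>" using y \<delta>(2)[OF s] by linarith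
        also have "\<dots> \<le> c" using \<epsilon> by simp
        finally show "y = f s" using gap \<delta>(2)[OF s] y by blast
      qed
      then show ?thesis using \<delta>(1) by blast
    qed
    moreover have "0 < c / 2" using c by simp
    moreover have "A s0 (f s0)" using s0 True unfolding K_def by simp
    ultimately show ?thesis unfolding regular_at_def by blast
  next
    case False
    have c2: "0 < c / 2" using c by simp
    then obtain \<delta> where \<delta>: "\<delta> > 0" "\<And>s. \<bar>s - s0\<bar> < \<delta> \<Longrightarrow> \<bar>f s - f s0\<bar> < c / 2 \<and> s \<in> K b"
      using cont by blast
    have "\<not> A s y" if "\<bar>s - s0\<bar> < \<delta> \<and> \<bar>y - f s0\<bar> < c / 2" for s y
    proof
      assume "A s y"
      have s: "\<bar>f s - f s0\<bar> < c / 2" "s \<in> K b" using \<delta>(2) that by auto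
      then have "\<bar>y - f s\<bar> < c / 2 + c / 2" using that by linarith
      then have "y = f s" using gap s \<open>A s y\<close> by simp
      then show False using \<open>A s y\<close> s(2) False unfolding K_def by simp
    qed
    then show ?thesis using c2 \<delta>(1) unfolding regular_at_def by blast
  qed
  then show False using f(3) s0 unfolding K_def G_def by blast
qed

text \<open>Regularity continues each point of the fibre uniquely to nearby \<open>s\<close>. That
  no further points appear would follow from compactness of \<open>[-1, 1]\<close>; here one takes
  the supremum of the heights up to which nearby fibres stay close to the fibre at
  \<open>s0\<close>, and regularity at that supremum carries the property past it.\<close>

lemma card_locally_constant:
  assumes A: "drel A" and fin: "finite {y. A s0 y}" and bd: "\<And>s y. A s y \<Longrightarrow> \<bar>y\<bar> \<le> 1"
    and reg: "\<not> critical A s0"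
  shows "\<exists>\<delta>>0. \<forall>s. \<bar>s - s0\<bar> < \<delta> \<longrightarrow> card {y. A s y} = card {y. A s0 y}"
proof -
  define Y where "Y = {y. A s0 y}"
  have Y: "finite Y" using fin by (simp add: Y_def)
  define N where "N y \<epsilon> s \<longleftrightarrow> (\<exists>y'. A s y' \<and> \<bar>y' - y\<bar> < \<epsilon> \<and>
    (\<forall>y''. A s y'' \<and> \<bar>y'' - y\<bar> < \<epsilon> \<longrightarrow> y'' = y'))" for y \<epsilon> s
  have "\<forall>y\<in>Y. \<exists>\<epsilon>0. 0 < \<epsilon>0 \<and> (\<forall>\<epsilon>. 0 < \<epsilon> \<and> \<epsilon> \<le> \<epsilon>0 \<longrightarrow> (\<exists>\<delta>>0. \<forall>s. \<bar>s - s0\<bar> < \<delta> \<longrightarrow> N y \<epsilon> s))"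
  proof
    fix y assume y: "y \<in> Y"
    have Ay: "A s0 y" using y by (simp add: Y_def)
    have r: "regular_at A s0 y" using reg bd[OF Ay] unfolding critical_def by blast
    have "\<not> (\<exists>\<epsilon>>0. \<exists>\<delta>>0. \<forall>s' y'. \<bar>s' - s0\<bar> < \<delta> \<and> \<bar>y' - y\<bar> < \<epsilon> \<longrightarrow> \<not> A s' y')"
    proof
      assume "\<exists>\<epsilon>>0. \<exists>\<delta>>0. \<forall>s' y'. \<bar>s' - s0\<bar> < \<delta> \<and> \<bar>y' - y\<bar> < \<epsilon> \<longrightarrow> \<not> A s' y'"
      then obtain \<epsilon> \<delta> where "\<epsilon> > 0" "\<delta> > 0" "\<forall>s' y'. \<bar>s' - s0\<bar> < \<delta> \<and> \<bar>y' - y\<bar> < \<epsilon> \<longrightarrow> \<not> A s' y'" by blast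
      then show False using Ay by (metis abs_zero cancel_comm_monoid_add_class.diff_cancel)
    qed
    then show "\<exists>\<epsilon>0. 0 < \<epsilon>0 \<and> (\<forall>\<epsilon>. 0 < \<epsilon> \<and> \<epsilon> \<le> \<epsilon>0 \<longrightarrow> (\<exists>\<delta>>0. \<forall>s. \<bar>s - s0\<bar> < \<delta> \<longrightarrow> N y \<epsilon> s))"
      using r unfolding regular_at_def N_def by blast
  qed
  from bchoice[OF this] obtain \<epsilon>0 where \<epsilon>0: "\<And>y. y \<in> Y \<Longrightarrow> \<epsilon>0 y > 0"
    "\<And>y \<epsilon>. y \<in> Y \<Longrightarrow> 0 < \<epsilon> \<Longrightarrow> \<epsilon> \<le> \<epsilon>0 y \<Longrightarrow> \<exists>\<delta>>0. \<forall>s. \<bar>s - s0\<bar> < \<delta> \<longrightarrow> N y \<epsilon> s"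
    by blast
  obtain gap where gap: "\<And>y. gap y > 0" "\<And>y p. p \<in> Y \<Longrightarrow> p \<noteq> y \<Longrightarrow> gap y \<le> \<bar>p - y\<bar>"
    using finite_gap[OF Y] by metis
  \<comment> \<open>At most half of each gap, so that the \<open>\<epsilon>\<close>-neighbourhoods
    of the points of \<open>Y\<close> are disjoint and the continuation map \<open>g\<close> is
    injective.\<close>
  obtain \<epsilon> where \<epsilon>: "\<epsilon> > 0" "\<And>y. y \<in> Y \<Longrightarrow> \<epsilon> \<le> min (\<epsilon>0 y) (gap y / 2)"
    using finite_pos_lb[OF Y, of "\<lambda>y. min (\<epsilon>0 y) (gap y / 2)"] \<epsilon>0(1) gap(1) by auto
  have "\<forall>y\<in>Y. \<exists>\<delta>. 0 < \<delta> \<and> (\<forall>s. \<bar>s - s0\<bar> < \<delta> \<longrightarrow> N y \<epsilon> s)"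
    using \<epsilon>0(2)[OF _ \<epsilon>(1)] \<epsilon>(2) by simp
  from bchoice[OF this] obtain \<delta>0 where \<delta>0: "\<And>y. y \<in> Y \<Longrightarrow> \<delta>0 y > 0"
    "\<And>y s. y \<in> Y \<Longrightarrow> \<bar>s - s0\<bar> < \<delta>0 y \<Longrightarrow> N y \<epsilon> s"
    by blast
  obtain \<delta>1 where \<delta>1: "\<delta>1 > 0" "\<And>y. y \<in> Y \<Longrightarrow> \<delta>1 \<le> \<delta>0 y"
    using finite_pos_lb[OF Y, of \<delta>0] \<delta>0(1) by blast
  define W where "W = {u. \<exists>\<delta>>0. \<forall>s y'. \<bar>s - s0\<bar> < \<delta> \<and> A s y' \<and> y' \<le> u \<longrightarrow> (\<exists>y. A s0 y \<and> \<bar>y' - y\<bar> < \<epsilon>)}"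
  have W: "dset W" unfolding W_def by (intro dsetI dfn_intros dfn_drel[OF A])
  have Wext: "u + h \<in> W"
    if u: "u \<in> W" and \<delta>: "\<delta> > 0"
      and H: "\<And>s y'. \<bar>s - s0\<bar> < \<delta> \<Longrightarrow> A s y' \<Longrightarrow> u < y' \<Longrightarrow> y' \<le> u + h \<Longrightarrow> \<exists>y. A s0 y \<and> \<bar>y' - y\<bar> < \<epsilon>"
    for u h \<delta>
  proof -
    obtain \<delta>' where \<delta>': "\<delta>' > 0" "\<And>s y'. \<bar>s - s0\<bar> < \<delta>' \<Longrightarrow> A s y' \<Longrightarrow> y' \<le> u \<Longrightarrow> \<exists>y. A s0 y \<and> \<bar>y' - y\<bar> < \<epsilon>"
      using u unfolding W_def by blast
    have "\<exists>y. A s0 y \<and> \<bar>y' - y\<bar> < \<epsilon>" if "\<bar>s - s0\<bar> < min \<delta> \<delta>' \<and> A s y' \<and> y' \<le> u + h" for s y'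
      using H[of s y'] \<delta>'(2)[of s y'] that by (cases "y' \<le> u") auto
    moreover have "min \<delta> \<delta>' > 0" using \<delta> \<delta>'(1) by simp
    ultimately show ?thesis unfolding W_def by blast
  qed
  have "2 \<in> W"
  proof (rule ccontr)
    assume n2: "2 \<notin> W"
    have m2: "-2 \<in> W" unfolding W_def
    proof (rule CollectI, rule exI[of _ 1], intro conjI allI impI)
      fix s y' assume "\<bar>s - s0\<bar> < 1 \<and> A s y' \<and> y' \<le> -2"
      then show "\<exists>y. A s0 y \<and> \<bar>y' - y\<bar> < \<epsilon>" using bd[of s y'] by (auto simp: abs_le_iff)
    qed simp
    have le1: "u \<le> 1" if u: "u \<in> W" for u
    proof (rule ccontr)
      assume "\<not> u \<le> 1"
      then have "u + (2 - u) \<in> W" using bd by (intro Wext[OF u zero_less_one]) (force simp: abs_le_iff)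
      then show False using n2 by simp
    qed
    have "\<exists>w. (\<forall>y\<in>W. y \<le> w) \<and> (\<forall>u. (\<forall>y\<in>W. y \<le> u) \<longrightarrow> w \<le> u)"
      by (rule tame_sup[OF dset_tame[OF W] m2 le1])
    then obtain w where w: "\<And>y. y \<in> W \<Longrightarrow> y \<le> w" "\<And>u. (\<forall>y\<in>W. y \<le> u) \<Longrightarrow> w \<le> u" by blast
    have near: "\<exists>u\<in>W. w - h < u" if "h > 0" for h
    proof (rule ccontr)
      assume "\<not> ?thesis"
      then have "w \<le> w - h" by (intro w(2)) force
      then show False using that by simp
    qed
    have w1: "w \<le> 1" using le1 by (intro w(2)) blast
    consider "w < -1" | "\<bar>w\<bar> \<le> 1" using w1 by (cases "w < -1") (auto simp: abs_le_iff)
    then show False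
    proof cases
      case 1
      obtain u where u: "u \<in> W" using m2 by blast
      \<comment> \<open>Fibres are empty below \<open>-1\<close>, so the midpoint of
        \<open>w\<close> and \<open>-1\<close> still belongs to \<open>W\<close>.\<close>
      have "u + ((w - 1) / 2 - u) \<in> W"
      proof (rule Wext[OF u zero_less_one])
        fix s y' assume "A s y'" "y' \<le> u + ((w - 1) / 2 - u)"
        then have "y' \<le> (w - 1) / 2" by simp
        also have "\<dots> < -1" using 1 by (simp add: field_simps)
        finally show "\<exists>y. A s0 y \<and> \<bar>y' - y\<bar> < \<epsilon>" using bd[OF \<open>A s y'\<close>] by (auto simp: abs_le_iff)
      qed
      then have "(w - 1) / 2 \<le> w" using w(1)[of "(w - 1) / 2"] by simp
      then show False using 1 by (simp add: field_simps)
    next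
      case 2
      then have r: "regular_at A s0 w" using reg unfolding critical_def by blast
      \<comment> \<open>If \<open>w\<close> is in the fibre at \<open>s0\<close>, it is itself the
        close point; otherwise regularity leaves only the empty box.\<close>
      have "\<exists>h>0. \<exists>\<delta>>0. \<forall>s y'. \<bar>s - s0\<bar> < \<delta> \<and> A s y' \<and> \<bar>y' - w\<bar> < h \<longrightarrow> (\<exists>y. A s0 y \<and> \<bar>y' - y\<bar> < \<epsilon>)"
      proof (cases "A s0 w")
        case True
        then show ?thesis using \<epsilon>(1) by (intro exI[of _ \<epsilon>] conjI exI[of _ 1]) auto
      next
        case False
        then show ?thesis using r unfolding regular_at_def by blast
      qed
      then obtain h \<delta> where h: "h > 0" "\<delta> > 0"
        "\<And>s y'. \<bar>s - s0\<bar> < \<delta> \<Longrightarrow> A s y' \<Longrightarrow> \<bar>y' - w\<bar> < h \<Longrightarrow> \<exists>y. A s0 y \<and> \<bar>y' - y\<bar> < \<epsilon>" by blast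
      obtain u where u: "u \<in> W" "w - h < u" using near h(1) by blast
      have "u + (w + h / 2 - u) \<in> W"
      proof (rule Wext[OF u(1) h(2)])
        fix s y' assume "\<bar>s - s0\<bar> < \<delta>" "A s y'" "u < y'" "y' \<le> u + (w + h / 2 - u)"
        moreover have "h / 2 < h" using h(1) by simp
        ultimately have "\<bar>y' - w\<bar> < h" using u(2) by (simp add: abs_less_iff)
        then show "\<exists>y. A s0 y \<and> \<bar>y' - y\<bar> < \<epsilon>" using h(3) \<open>\<bar>s - s0\<bar> < \<delta>\<close> \<open>A s y'\<close> by blast
      qed
      then have "w + h / 2 \<le> w" using w(1)[of "w + h / 2"] by simp
      then show False using h(1) by simp
    qed
  qed
  then obtain \<delta>2 where \<delta>2: "\<delta>2 > 0"
    "\<And>s y'. \<bar>s - s0\<bar> < \<delta>2 \<Longrightarrow> A s y' \<Longrightarrow> y' \<le> 2 \<Longrightarrow> \<exists>y. A s0 y \<and> \<bar>y' - y\<bar> < \<epsilon>"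
    unfolding W_def by blast
  have "card {y. A s y} = card {y. A s0 y}" if s: "\<bar>s - s0\<bar> < min \<delta>1 \<delta>2" for s
  proof -
    have "N y \<epsilon> s" if "y \<in> Y" for y
      using \<delta>0(2)[OF that, of s] \<delta>1(2)[OF that] s by simp
    then have "\<forall>y\<in>Y. \<exists>y'. A s y' \<and> \<bar>y' - y\<bar> < \<epsilon> \<and> (\<forall>y''. A s y'' \<and> \<bar>y'' - y\<bar> < \<epsilon> \<longrightarrow> y'' = y')"
      unfolding N_def by blast
    from bchoice[OF this] obtain g where g: "\<And>y. y \<in> Y \<Longrightarrow> A s (g y)" "\<And>y. y \<in> Y \<Longrightarrow> \<bar>g y - y\<bar> < \<epsilon>"
      "\<And>y y'. y \<in> Y \<Longrightarrow> A s y' \<Longrightarrow> \<bar>y' - y\<bar> < \<epsilon> \<Longrightarrow> y' = g y"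
      by blast
    have "bij_betw g Y {y. A s y}"
    proof (rule bij_betwI')
      fix y z assume yz: "y \<in> Y" "z \<in> Y"
      show "g y = g z \<longleftrightarrow> y = z"
      proof (rule iffI, rule ccontr)
        assume eq: "g y = g z" and ne: "y \<noteq> z"
        have "\<bar>g y - y\<bar> < \<epsilon>" "\<bar>g y - z\<bar> < \<epsilon>" using g(2)[of y] g(2)[of z] yz eq by auto
        then have "\<bar>z - y\<bar> < \<epsilon> + \<epsilon>" by linarith
        also have "\<dots> \<le> gap y" using \<epsilon>(2)[OF yz(1)] by simp
        finally show False using gap(2)[of z y] yz ne by simp
      qed simp
    next
      fix y assume "y \<in> Y" then show "g y \<in> {y. A s y}" using g by simp
    next
      fix y' assume "y' \<in> {y. A s y}"
      then have "A s y'" by simp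
      moreover from this have "y' \<le> 2" using bd[of s y'] by (auto simp: abs_le_iff)
      ultimately obtain y where "A s0 y" "\<bar>y' - y\<bar> < \<epsilon>" using \<delta>2(2)[of s y'] s by auto
      then show "\<exists>y\<in>Y. y' = g y" using g(3) \<open>A s y'\<close> unfolding Y_def by blast
    qed
    then show ?thesis unfolding Y_def by (simp add: bij_betw_same_card)
  qed
  moreover have "min \<delta>1 \<delta>2 > 0" using \<delta>1(1) \<delta>2(1) by simp
  ultimately show ?thesis by blast
qed

end

text \<open>Expresses that \<open>X\<close> has at least \<open>k\<close> elements below
  \<open>t\<close>. For fixed \<open>k\<close> it unfolds to a first-order formula, which a
  statement about \<open>card\<close> does not.\<close>

fun count_below :: "nat \<Rightarrow> 'a::linorder set \<Rightarrow> 'a \<Rightarrow> bool" where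
  "count_below 0 X t = True"
| "count_below (Suc k) X t = (\<exists>u. u \<in> X \<and> u < t \<and> count_below k X u)"

lemma count_below_iff:
  assumes "finite X" shows "count_below k X t \<longleftrightarrow> k \<le> card {u \<in> X. u < t}"
proof (induction k arbitrary: t)
  case (Suc k)
  let ?B = "\<lambda>t. {u \<in> X. u < t}"
  have fin: "finite (?B t)" for t using assms by simp
  show ?case
  proof
    assume "count_below (Suc k) X t"
    then obtain u where u: "u \<in> X" "u < t" "k \<le> card (?B u)" using Suc.IH by auto
    have "Suc k \<le> card (insert u (?B u))" using u fin by simp
    also have "\<dots> \<le> card (?B t)" using u by (intro card_mono fin) auto
    finally show "Suc k \<le> card (?B t)" .
  next
    assume k: "Suc k \<le> card (?B t)"
    then have ne: "?B t \<noteq> {}" by (intro notI) simp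
    define u where "u = Max (?B t)"
    have u: "u \<in> ?B t" "\<And>v. v \<in> ?B t \<Longrightarrow> v \<le> u"
      using Max_in[OF fin ne] Max_ge[OF fin] unfolding u_def by blast+
    have "?B u = ?B t - {u}" using u by (auto simp: less_le)
    then have "k \<le> card (?B u)" using k u(1) fin by simp
    then show "count_below (Suc k) X t" using u(1) Suc.IH by auto
  qed
qed simp

text \<open>The listed points are definable from \<open>B\<close>, meet every component of its
  complement, and include \<open>B\<close> itself because \<open>b = (b + b) / 2\<close>. Midpoints
  serve between neighbours, \<open>b + 1\<close> and \<open>b - 1\<close> beyond the extremes, and
  \<open>0\<close> if \<open>B\<close> is empty.\<close>

lemma sample_point:
  fixes s :: "'a::linordered_field"
  assumes B: "finite B"
  shows "\<exists>m. (m = 0 \<or> (\<exists>b b'. b \<in> B \<and> b' \<in> B \<and> m = (b + b') / 2) \<or> (\<exists>b. b \<in> B \<and> (m = b + 1 \<or> m = b - 1))) \<and>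
    (m = s \<or> {min s m..max s m} \<inter> B = {})"
proof (cases "s \<in> B")
  case True
  then show ?thesis by (intro exI[of _ s] conjI disjI1 disjI2) (auto intro!: bexI[of _ s] exI[of _ s])
next
  case False
  let ?L = "{b \<in> B. b < s}" and ?U = "{b \<in> B. s < b}"
  have fin: "finite ?L" "finite ?U" using B by auto
  have L: "Max ?L \<in> B" "Max ?L < s" "\<And>b. b \<in> B \<Longrightarrow> b < s \<Longrightarrow> b \<le> Max ?L" if "?L \<noteq> {}"
    using Max_in[OF fin(1) that] Max_ge[OF fin(1)] by auto
  have U: "Min ?U \<in> B" "s < Min ?U" "\<And>b. b \<in> B \<Longrightarrow> s < b \<Longrightarrow> Min ?U \<le> b" if "?U \<noteq> {}"
    using Min_in[OF fin(2) that] Min_le[OF fin(2)] by auto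
  have sb: "b < s \<or> s < b" if "b \<in> B" for b using that False by (metis linorder_neqE)
  consider (0) "?L = {}" "?U = {}" | (1) "?L = {}" "?U \<noteq> {}" | (2) "?L \<noteq> {}" "?U = {}" | (3) "?L \<noteq> {}" "?U \<noteq> {}"
    by blast
  then show ?thesis
  proof cases
    case 0
    then have "B = {}" using sb by blast
    then show ?thesis by (intro exI[of _ 0]) auto
  next
    case 1
    have "b \<notin> B" if "b \<in> {min s (Min ?U - 1)..max s (Min ?U - 1)}" for b
    proof
      assume b: "b \<in> B"
      then have "Min ?U \<le> b" using U(3)[OF 1(2)] sb 1(1) by blast
      then show False using that U(2)[OF 1(2)] by (auto simp: max_def split: if_splits)
    qed
    then show ?thesis using U(1)[OF 1(2)] by blast
  next
    case 2
    have "b \<notin> B" if "b \<in> {min s (Max ?L + 1)..max s (Max ?L + 1)}" for b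
    proof
      assume b: "b \<in> B"
      then have "b \<le> Max ?L" using L(3)[OF 2(1)] sb 2(2) by blast
      then show False using that L(2)[OF 2(1)] by (auto simp: min_def split: if_splits)
    qed
    then show ?thesis using L(1)[OF 2(1)] by blast
  next
    case 3
    define x y m where "x = Max ?L" and "y = Min ?U" and "m = (x + y) / 2"
    have xy: "x \<in> B" "x < s" "y \<in> B" "s < y" using L[OF 3(1)] U[OF 3(2)] by (auto simp: x_def y_def)
    then have m: "x < m" "m < y" unfolding m_def by (auto simp: field_simps)
    have "b \<notin> B" if "b \<in> {min s m..max s m}" for b
    proof
      assume b: "b \<in> B"
      have "b \<le> x \<or> y \<le> b" using sb[OF b] L(3)[OF 3(1) b] U(3)[OF 3(2) b] by (auto simp: x_def y_def)
      moreover have "x < b" "b < y" using that xy m by (auto simp: min_def max_def split: if_splits)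
      ultimately show False by auto
    qed
    then show ?thesis using xy m_def by blast
  qed
qed

section \<open>Bounds uniform in the parameters\<close>

context o_minimal_structure
begin

lemma dfn_count_below:
  fixes X :: "('i \<Rightarrow> 'a) \<Rightarrow> 'a set"
  assumes X: "dfn (\<lambda>e. e None \<in> X (\<lambda>i. e (Some i)))"
  shows "dfn (\<lambda>e. count_below k (X (\<lambda>i. e (Some i))) (e None))"
proof (induction k)
  case 0
  show ?case by (simp add: dfn_intros)
next
  case (Suc k)
  have "dfn (\<lambda>e. e None \<in> X (\<lambda>i. e (Some (Some i))))"
    using dfn_rename[OF X, of "map_option Some"] by simp
  moreover have "dfn (\<lambda>e. count_below k (X (\<lambda>i. e (Some (Some i)))) (e None))"
    using dfn_rename[OF Suc.IH, of "map_option Some"] by simp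
  ultimately show ?case unfolding count_below.simps by (intro dfn_intros)
qed

lemma card_constant:
  assumes A: "drel A" and fin: "\<And>s. finite {y. A s y}" and bd: "\<And>s y. A s y \<Longrightarrow> \<bar>y\<bar> \<le> 1"
    and le: "s1 \<le> s2" and reg: "\<And>s. s1 \<le> s \<Longrightarrow> s \<le> s2 \<Longrightarrow> \<not> critical A s"
  shows "card {y. A s1 y} = card {y. A s2 y}"
proof -
  define k where "k = card {y. A s1 y}"
  \<comment> \<open>All points of the fibres are at most \<open>1\<close>, so counting below
    \<open>2\<close> counts the whole fibre.\<close>
  have c2: "count_below j {y. A s y} 2 \<longleftrightarrow> j \<le> card {y. A s y}" for j s
  proof -
    have "y < 2" if "A s y" for y using bd[OF that] by (auto simp: abs_le_iff)
    then have "{u \<in> {y. A s y}. u < 2} = {y. A s y}" by auto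
    then show ?thesis using count_below_iff[OF fin, of j s 2] by simp
  qed
  have "dfn (\<lambda>e::unit option \<Rightarrow> 'a. e None \<in> {y. A (e (Some ())) y})"
    unfolding mem_Collect_eq by (intro dfn_drel[OF A] dfn_intros)
  then have "dfn (\<lambda>e::unit option \<Rightarrow> 'a. count_below j {y. A (e (Some ())) y} (e None))" for j
    by (rule dfn_count_below[of "\<lambda>e::unit \<Rightarrow> 'a. {y. A (e ()) y}"])
  then have "dfn (\<lambda>e::unit \<Rightarrow> 'a. \<exists>t. t = 2 \<and> count_below j {y. A (e ()) y} t)" for j
    by (intro dfn_intros)
  then have cb: "dfn (\<lambda>e::unit \<Rightarrow> 'a. j \<le> card {y. A (e ()) y})" for j by (simp add: c2)
  have "dset {s. k \<le> card {y. A s y} \<and> \<not> Suc k \<le> card {y. A s y}}"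
    by (intro dsetI dfn_conj dfn_not cb)
  then have Z: "dset {s. card {y. A s y} = k}"
    by (rule back_subst[of dset]) auto
  have "s1 \<in> {s. card {y. A s y} = k} \<longleftrightarrow> s2 \<in> {s. card {y. A s y} = k}"
  proof (rule definable_connected[OF Z le])
    fix s assume "s1 \<le> s" "s \<le> s2"
    then have "\<not> critical A s" by (rule reg)
    then have "\<exists>\<delta>>0. \<forall>s'. \<bar>s' - s\<bar> < \<delta> \<longrightarrow> card {y. A s' y} = card {y. A s y}"
      by (intro card_locally_constant[OF A fin]) (rule bd)
    then obtain \<delta> where \<delta>: "\<delta> > 0" "\<forall>s'. \<bar>s' - s\<bar> < \<delta> \<longrightarrow> card {y. A s' y} = card {y. A s y}" by blast
    show "\<exists>\<delta>>0. \<forall>s'. s1 \<le> s' \<and> s' \<le> s2 \<and> \<bar>s' - s\<bar> < \<delta> \<longrightarrow>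
      (s' \<in> {s. card {y. A s y} = k} \<longleftrightarrow> s \<in> {s. card {y. A s y} = k})"
    proof (intro exI[of _ \<delta>] conjI allI impI)
      fix s' assume "s1 \<le> s' \<and> s' \<le> s2 \<and> \<bar>s' - s\<bar> < \<delta>"
      then have "card {y. A s' y} = card {y. A s y}" using \<delta>(2) by blast
      then show "s' \<in> {s. card {y. A s y} = k} \<longleftrightarrow> s \<in> {s. card {y. A s y} = k}"
        unfolding mem_Collect_eq by (rule arg_cong)
    qed (rule \<delta>(1))
  qed
  then show ?thesis by (simp add: k_def)
qed

lemma uniform_finiteness_bounded:
  fixes A :: "(nat \<Rightarrow> 'a) \<Rightarrow> 'a set"
  assumes "dfn (\<lambda>e. e None \<in> A (\<lambda>i. e (Some i)))"
    and "\<And>e e'. (\<And>i. i < n \<Longrightarrow> e i = e' i) \<Longrightarrow> A e = A e'"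
    and "\<And>e. finite (A e)" and "\<And>e y. y \<in> A e \<Longrightarrow> \<bar>y\<bar> \<le> 1"
  shows "\<exists>N. \<forall>e. card (A e) \<le> N"
  using assms
proof (induction n arbitrary: A)
  case 0
  have "A e = A (\<lambda>_. 0)" for e by (rule 0(2)) simp
  then have "card (A e) \<le> card (A (\<lambda>_. 0))" for e by (metis order_refl)
  then show ?case by blast
next
  case (Suc n)
  note dA = Suc.prems(1) and dep = Suc.prems(2) and finA = Suc.prems(3) and bdA = Suc.prems(4)
  \<comment> \<open>\<open>s\<close> is the parameter to be eliminated; \<open>e\<close> holds the
    others.\<close>
  define R where "R e s y \<longleftrightarrow> y \<in> A (case_nat s e)" for e s y
  have ren: "dfn (\<lambda>e. R (\<lambda>i. e (h i)) (e k) (e j))" for h :: "nat \<Rightarrow> 'i" and k j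
  proof -
    have "(\<lambda>i. e (case i of 0 \<Rightarrow> k | Suc i \<Rightarrow> h i)) = case_nat (e k) (\<lambda>i. e (h i))" for e :: "'i \<Rightarrow> 'a"
      by (auto split: nat.split)
    then show ?thesis
      using dfn_rename[OF dA, of "case_option j (case_nat k h)"] unfolding R_def by simp
  qed
  have R: "drel (R e)" for e by (rule drel_slice) (rule ren)
  have finR: "finite {y. R e s y}" and bdR: "R e s y \<Longrightarrow> \<bar>y\<bar> \<le> 1" for e s y
    using finA bdA unfolding R_def by auto
  define B where "B e = {s. critical (R e) s}" for e
  have finB: "finite (B e)" for e unfolding B_def by (rule critical_finite[OF R finR])
  have dB: "dfn (\<lambda>e. e k \<in> B (\<lambda>i. e (h i)))" for h :: "nat \<Rightarrow> 'i" and k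
    unfolding B_def mem_Collect_eq critical_def regular_at_def by (intro dfn_intros ren)
  \<comment> \<open>The candidates of \<open>sample_point\<close> for \<open>B e\<close>. They
    depend on \<open>e\<close> alone, so \<open>U\<close> has one parameter less than
    \<open>A\<close>.\<close>
  define M where "M e m \<longleftrightarrow> m = 0 \<or> (\<exists>b b'. b \<in> B e \<and> b' \<in> B e \<and> m = (b + b') / 2) \<or>
    (\<exists>b. b \<in> B e \<and> (m = b + 1 \<or> m = b - 1))" for e m
  define U where "U e = {y. \<exists>m. M e m \<and> R e m y}" for e
  have finM: "finite {m. M e m}" for e
  proof -
    have "{m. M e m} \<subseteq> insert 0 ((\<lambda>(b, b'). (b + b') / 2) ` (B e \<times> B e) \<union> (\<lambda>b. b + 1) ` B e \<union> (\<lambda>b. b - 1) ` B e)"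
      unfolding M_def by (force simp del: divide_eq_eq_numeral1)
    then show ?thesis by (rule finite_subset) (simp add: finB)
  qed
  have "\<exists>N. \<forall>e. card (U e) \<le> N"
  proof (rule Suc.IH)
    show "dfn (\<lambda>e. e None \<in> U (\<lambda>i. e (Some i)))"
      unfolding U_def mem_Collect_eq M_def by (intro dfn_intros dB ren)
    fix e e' :: "nat \<Rightarrow> 'a"
    assume "\<And>i. i < n \<Longrightarrow> e i = e' i"
    then have "R e = R e'" unfolding R_def by (intro ext arg_cong2[of _ _ _ _ "(\<in>)"] dep) (auto split: nat.split)
    then show "U e = U e'" unfolding U_def M_def B_def by simp
  next
    fix e
    have "U e = (\<Union>m\<in>{m. M e m}. {y. R e m y})" unfolding U_def by blast
    then show "finite (U e)" using finM finR by simp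
  next
    fix e y assume "y \<in> U e" then show "\<bar>y\<bar> \<le> 1" using bdR unfolding U_def by blast
  qed
  then obtain N where N: "\<And>e. card (U e) \<le> N" by blast
  have finU: "finite (U e)" for e
  proof -
    have "U e = (\<Union>m\<in>{m. M e m}. {y. R e m y})" unfolding U_def by blast
    then show ?thesis using finM finR by simp
  qed
  have "card (A e) \<le> N" for e
  proof -
    define s e' where "s = e 0" and "e' = (\<lambda>i. e (Suc i))"
    have "case_nat s e' = e" by (auto simp: s_def e'_def split: nat.split)
    then have AR: "A e = {y. R e' s y}" unfolding R_def by simp
    obtain m where m: "M e' m" "m = s \<or> {min s m..max s m} \<inter> B e' = {}"
      using sample_point[OF finB, of e' s] unfolding M_def by blast
    \<comment> \<open>Either \<open>m\<close> is \<open>s\<close>, or the segment between them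
      contains no critical parameter and the number of points cannot change along it.\<close>
    have "card {y. R e' s y} = card {y. R e' m y}"
      using m(2)
    proof
      assume "{min s m..max s m} \<inter> B e' = {}"
      then have "card {y. R e' (min s m) y} = card {y. R e' (max s m) y}"
        by (intro card_constant[OF R finR bdR]) (auto simp: B_def)
      then show ?thesis by (cases "s \<le> m") (auto simp: min_def max_def)
    qed simp
    also have "\<dots> \<le> card (U e')" using m(1) by (intro card_mono finU) (auto simp: U_def)
    also have "\<dots> \<le> N" by (rule N)
    finally show ?thesis by (simp add: AR)
  qed
  then show ?case by blast
qed

lemma dfn_finite_support:
  assumes "dfn P" shows "\<exists>L. finite L \<and> (\<forall>e e'. (\<forall>i\<in>L. e i = e' i) \<longrightarrow> P e = P e')"
proof -
  obtain "is" A where A: "\<And>e. P e \<longleftrightarrow> map e is \<in> A" using assms unfolding dfn_def by blast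
  have "P e = P e'" if "\<forall>i\<in>set is. e i = e' i" for e e'
    using that by (simp add: A cong: map_cong)
  then show ?thesis by blast
qed

text \<open>The definable injection \<open>y / (1 + |y|)\<close> moves the fibres into
  \<open>(-1, 1)\<close>, and the number \<open>n\<close> of relevant parameters comes from the
  finitely many variables that a formula reads.\<close>

theorem uniform_finiteness:
  fixes A :: "(nat \<Rightarrow> 'a) \<Rightarrow> 'a set"
  assumes dA: "dfn (\<lambda>e. e None \<in> A (\<lambda>i. e (Some i)))" and fin: "\<And>e. finite (A e)"
  shows "\<exists>N. \<forall>e. card (A e) \<le> N"
proof -
  obtain L :: "nat option set" where L: "finite L"
    "\<And>e e'. (\<forall>i\<in>L. e i = e' i) \<Longrightarrow> (e None \<in> A (\<lambda>i. e (Some i))) = (e' None \<in> A (\<lambda>i. e' (Some i)))"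
    using dfn_finite_support[OF dA] by blast
  obtain n where n: "\<And>i. Some i \<in> L \<Longrightarrow> i < n"
    using finite_nat_set_iff_bounded[of "Some -` L"] finite_vimageI[OF L(1), of Some] by auto
  have dep: "A e = A e'" if "\<And>i. i < n \<Longrightarrow> e i = e' i" for e e'
  proof (rule set_eqI)
    fix y
    have "\<forall>i\<in>L. case_option y e i = case_option y e' i"
    proof
      fix i assume "i \<in> L"
      then show "case_option y e i = case_option y e' i" using that n by (cases i) auto
    qed
    from L(2)[OF this] show "y \<in> A e \<longleftrightarrow> y \<in> A e'" by simp
  qed
  define g where "g y = y / (1 + \<bar>y\<bar>)" for y :: 'a
  have pos: "1 + \<bar>y\<bar> > 0" for y :: 'a by (simp add: add_pos_nonneg)
  have g1: "\<bar>g y\<bar> < 1" for y unfolding g_def by (simp add: abs_divide pos divide_less_eq abs_of_pos[OF pos])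
  have ginv: "g y / (1 - \<bar>g y\<bar>) = y" for y
  proof -
    have "\<bar>g y\<bar> = \<bar>y\<bar> / (1 + \<bar>y\<bar>)" unfolding g_def by (simp add: abs_divide abs_of_pos[OF pos])
    then have "1 - \<bar>g y\<bar> = 1 / (1 + \<bar>y\<bar>)" using pos[of y] by (simp add: field_simps)
    then show ?thesis using pos[of y] unfolding g_def by simp
  qed
  have inj: "inj g" by (rule inj_on_inverseI[where g = "\<lambda>u. u / (1 - \<bar>u\<bar>)"]) (rule ginv)
  have "\<exists>N. \<forall>e. card (g ` A e) \<le> N"
  proof (rule uniform_finiteness_bounded)
    have "dfn (\<lambda>e. e None \<in> A (\<lambda>i. e (Some (Some i))))"
      using dfn_rename[OF dA, of "map_option Some"] by simp
    then show "dfn (\<lambda>e. e None \<in> g ` A (\<lambda>i. e (Some i)))"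
      unfolding image_def Bex_def mem_Collect_eq g_def by (intro dfn_intros)
    show "g ` A e = g ` A e'" if "\<And>i. i < n \<Longrightarrow> e i = e' i" for e e'
      using dep[OF that] by simp
  qed (use fin g1 in \<open>auto intro: less_imp_le\<close>)
  moreover have "card (g ` A e) = card (A e)" for e by (rule card_image) (meson inj inj_on_subset subset_UNIV)
  ultimately show ?thesis by simp
qed

end

section \<open>Distal cells\<close>

definition boundary :: "'a::linordered_field set \<Rightarrow> 'a set" where
  "boundary X = {u. \<forall>\<epsilon>>0. (\<exists>y. \<bar>y - u\<bar> < \<epsilon> \<and> y \<in> X) \<and> (\<exists>y. \<bar>y - u\<bar> < \<epsilon> \<and> y \<notin> X)}"

text \<open>Off the break points membership is locally constant, so every boundary point is a break
  point.\<close>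

lemma tame_boundary_finite:
  fixes X :: "'a::linordered_field set"
  assumes "tame X" shows "finite (boundary X)"
proof -
  obtain P where P: "finite P" "\<And>a b. a \<le> b \<Longrightarrow> {a..b} \<inter> P = {} \<Longrightarrow> (a \<in> X \<longleftrightarrow> b \<in> X)"
    by (rule tameE[OF assms], rule that)
  have "u \<in> P" if u: "u \<in> boundary X" for u
  proof (rule ccontr)
    assume uP: "u \<notin> P"
    obtain \<delta> where \<delta>: "\<delta> > 0" "\<forall>p\<in>P. p \<noteq> u \<longrightarrow> \<delta> \<le> \<bar>p - u\<bar>" using finite_gap[OF P(1)] by blast
    have "y \<in> X \<longleftrightarrow> u \<in> X" if y: "\<bar>y - u\<bar> < \<delta>" for y
    proof -
      have "p \<notin> P" if p: "p \<in> {min y u..max y u}" for p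
      proof
        assume "p \<in> P"
        then have "\<delta> \<le> \<bar>p - u\<bar>" using \<delta>(2) uP by metis
        moreover have "\<bar>p - u\<bar> \<le> \<bar>y - u\<bar>" using p by (auto simp: min_def max_def split: if_splits)
        ultimately show False using y by simp
      qed
      then have "min y u \<in> X \<longleftrightarrow> max y u \<in> X" by (intro P(2)) auto
      then show ?thesis by (cases "y \<le> u") (auto simp: min_def max_def)
    qed
    then show False using u \<delta>(1) unfolding boundary_def by blast
  qed
  then show ?thesis using P(1) by (meson finite_subset subsetI)
qed

text \<open>A distal cell decomposition: each shape in \<open>C\<close> makes a cell out of
  \<open>k\<close> parameters. What sampling exploits is that the parameters come from
  \<open>B\<close> itself while \<open>k\<close> and \<open>C\<close> do not depend on
  \<open>B\<close>. Values in any type \<open>'z\<close> allow several relations to be treated as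
  one.\<close>

definition distal :: "('x \<Rightarrow> 'y \<Rightarrow> 'z) \<Rightarrow> bool" where
  "distal E \<longleftrightarrow> (\<exists>k C. finite C \<and> (\<forall>B. finite B \<and> B \<noteq> {} \<longrightarrow> (\<forall>x. \<exists>ps. length ps = k \<and> set ps \<subseteq> B \<and>
    (\<exists>c\<in>C. x \<in> c ps \<and> (\<forall>x'\<in>c ps. \<forall>b\<in>B. E x' b = E x b)))))"

lemma distalI:
  assumes "finite C"
    and "\<And>B x. finite B \<Longrightarrow> B \<noteq> {} \<Longrightarrow> \<exists>ps. length ps = k \<and> set ps \<subseteq> B \<and>
      (\<exists>c\<in>C. x \<in> c ps \<and> (\<forall>x'\<in>c ps. \<forall>b\<in>B. E x' b = E x b))"
  shows "distal E"
  using assms unfolding distal_def by blast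

lemma distalE:
  assumes "distal E"
  obtains k C where "finite C"
    "\<And>B x. finite B \<Longrightarrow> B \<noteq> {} \<Longrightarrow> \<exists>ps c. length ps = k \<and> set ps \<subseteq> B \<and>
      c \<in> C \<and> x \<in> c ps \<and> (\<forall>x'\<in>c ps. \<forall>b\<in>B. E x' b = E x b)"
  using assms unfolding distal_def by meson

lemma distal_const: "distal (\<lambda>x. E)"
  by (rule distalI[of "{\<lambda>_. UNIV}" 0]) auto

lemma distal_coarsen:
  assumes "distal E" "\<And>x x' b. E x b = E x' b \<Longrightarrow> F x b = F x' b"
  shows "distal F"
  using assms unfolding distal_def by meson

text \<open>Intersect a cell for \<open>E\<close> with a cell for \<open>F\<close>; since
  \<open>k\<close> is fixed, \<open>take k\<close> and \<open>drop k\<close> recover the two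
  parameter lists from their concatenation.\<close>

lemma distal_pair:
  fixes E :: "'x \<Rightarrow> 'y \<Rightarrow> 'z" and F :: "'x \<Rightarrow> 'y \<Rightarrow> 'w"
  assumes "distal E" "distal F" shows "distal (\<lambda>x b. (E x b, F x b))"
proof -
  obtain k C where C: "finite C" "\<And>B x. finite B \<Longrightarrow> B \<noteq> {} \<Longrightarrow> \<exists>ps c. length ps = k \<and> set ps \<subseteq> B \<and>
      c \<in> C \<and> x \<in> c ps \<and> (\<forall>x'\<in>c ps. \<forall>b\<in>B. E x' b = E x b)"
    by (rule distalE[OF assms(1)], rule that)
  obtain l D where D: "finite D" "\<And>B x. finite B \<Longrightarrow> B \<noteq> {} \<Longrightarrow> \<exists>ps c. length ps = l \<and> set ps \<subseteq> B \<and>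
      c \<in> D \<and> x \<in> c ps \<and> (\<forall>x'\<in>c ps. \<forall>b\<in>B. F x' b = F x b)"
    by (rule distalE[OF assms(2)], rule that)
  let ?C = "(\<lambda>(c, d) ps. c (take k ps) \<inter> d (drop k ps)) ` (C \<times> D)"
  show ?thesis
  proof (rule distalI[of ?C "k + l"])
    show "finite ?C" using C(1) D(1) by simp
    fix B x assume B: "finite (B :: 'y set)" "B \<noteq> {}"
    obtain ps c where c: "length ps = k" "set ps \<subseteq> B" "c \<in> C" "x \<in> c ps" "\<forall>x'\<in>c ps. \<forall>b\<in>B. E x' b = E x b"
      using C(2)[OF B] by blast
    obtain qs d where d: "length qs = l" "set qs \<subseteq> B" "d \<in> D" "x \<in> d qs" "\<forall>x'\<in>d qs. \<forall>b\<in>B. F x' b = F x b"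
      using D(2)[OF B] by blast
    let ?c = "\<lambda>ps. c (take k ps) \<inter> d (drop k ps)"
    have "?c \<in> ?C" using c(3) d(3) by (intro image_eqI[of _ _ "(c, d)"]) auto
    moreover have "?c (ps @ qs) = c ps \<inter> d qs" using c(1) by simp
    then have "x \<in> ?c (ps @ qs)" "\<forall>x'\<in>?c (ps @ qs). \<forall>b\<in>B. (E x' b, F x' b) = (E x b, F x b)"
      using c(4,5) d(4,5) by (simp, simp only: prod.inject) blast
    moreover have "length (ps @ qs) = k + l" "set (ps @ qs) \<subseteq> B" using c d by auto
    ultimately show "\<exists>ps. length ps = k + l \<and> set ps \<subseteq> B \<and>
        (\<exists>c\<in>?C. x \<in> c ps \<and> (\<forall>x'\<in>c ps. \<forall>b\<in>B. (E x' b, F x' b) = (E x b, F x b)))"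
      by (intro exI[of _ "ps @ qs"] conjI bexI[of _ ?c])
  qed
qed

lemma distal_finite_family:
  assumes "finite I" "\<And>i. i \<in> I \<Longrightarrow> distal (E i)"
  shows "distal (\<lambda>x b. {i \<in> I. E i x b})"
  using assms
proof (induction I rule: finite_induct)
  case empty
  show ?case by (simp add: distal_const)
next
  case (insert j I)
  have "distal (\<lambda>x b. (E j x b, {i \<in> I. E i x b}))" using insert by (intro distal_pair) auto
  then show ?case
    by (rule distal_coarsen) auto
qed

text \<open>Cells are pulled back along \<open>f\<close>. Their parameters lie in the image of
  \<open>B\<close> under \<open>g\<close>, and preimages have to be chosen because parameters must
  belong to \<open>B\<close>.\<close>

lemma distal_compose:
  fixes E :: "'x \<Rightarrow> 'y \<Rightarrow> 'z" and f :: "'u \<Rightarrow> 'x" and g :: "'v \<Rightarrow> 'y"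
  assumes "distal E" shows "distal (\<lambda>x y. E (f x) (g y))"
proof -
  obtain k C where C: "finite C" "\<And>B x. finite B \<Longrightarrow> B \<noteq> {} \<Longrightarrow> \<exists>ps c. length ps = k \<and> set ps \<subseteq> B \<and>
      c \<in> C \<and> x \<in> c ps \<and> (\<forall>x'\<in>c ps. \<forall>b\<in>B. E x' b = E x b)"
    by (rule distalE[OF assms(1)], rule that)
  let ?C = "(\<lambda>c ps. f -` c (map g ps)) ` C"
  show ?thesis
  proof (rule distalI[of ?C k])
    show "finite ?C" using C(1) by simp
    fix B x assume B: "finite (B :: 'v set)" "B \<noteq> {}"
    obtain ps c where c: "length ps = k" "set ps \<subseteq> g ` B" "c \<in> C" "f x \<in> c ps"
      "\<forall>x'\<in>c ps. \<forall>b\<in>g ` B. E x' b = E (f x) b"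
      using C(2)[of "g ` B" "f x"] B by blast
    have "\<forall>p\<in>set ps. \<exists>q. q \<in> B \<and> g q = p" using c(2) by auto
    from bchoice[OF this] obtain h where h: "\<forall>p\<in>set ps. h p \<in> B \<and> g (h p) = p" by blast
    define qs where "qs = map h ps"
    have qs: "map g qs = ps" "set qs \<subseteq> B" "length qs = length ps"
      using h by (auto simp: qs_def map_idI)
    show "\<exists>ps. length ps = k \<and> set ps \<subseteq> B \<and>
        (\<exists>c\<in>?C. x \<in> c ps \<and> (\<forall>x'\<in>c ps. \<forall>b\<in>B. E (f x') (g b) = E (f x) (g b)))"
    proof (intro exI[of _ qs] conjI bexI[of _ "\<lambda>ps. f -` c (map g ps)"] ballI)
      show "E (f x') (g b) = E (f x) (g b)" if "x' \<in> f -` c (map g qs)" "b \<in> B" for x' b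
        using that c(5) unfolding qs(1) by blast
      show "length qs = k" "set qs \<subseteq> B" using qs c(1) by simp_all
      show "x \<in> f -` c (map g qs)" using c(4) by (simp add: qs(1))
      show "(\<lambda>ps. f -` c (map g ps)) \<in> ?C" using c(3) by blast
    qed
  qed
qed

text \<open>Interleaving turns a relation on triples of parameters into one on single sequences, to
  which an induction hypothesis about sequences applies.\<close>

definition join3 :: "(nat \<Rightarrow> 'b) \<Rightarrow> (nat \<Rightarrow> 'b) \<Rightarrow> (nat \<Rightarrow> 'b) \<Rightarrow> nat \<Rightarrow> 'b" where
  "join3 p q r = (\<lambda>i. if i mod 3 = 0 then p (i div 3) else if i mod 3 = 1 then q (i div 3) else r (i div 3))"

lemma join3_nth [simp]:
  "join3 p q r (3 * i) = p i" "join3 p q r (Suc (3 * i)) = q i" "join3 p q r (Suc (Suc (3 * i))) = r i"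
proof -
  have "Suc (3 * i) mod 3 = 1" "Suc (3 * i) div 3 = i" "Suc (Suc (3 * i)) mod 3 = 2" "Suc (Suc (3 * i)) div 3 = i"
    by presburger+
  then show "join3 p q r (3 * i) = p i" "join3 p q r (Suc (3 * i)) = q i" "join3 p q r (Suc (Suc (3 * i))) = r i"
    unfolding join3_def by auto
qed

text \<open>Distality for the set of all triples from \<open>B\<close> gives a cell described by
  \<open>k\<close> triples; listing their first, then second, then third components describes it by
  \<open>3 * k\<close> members of \<open>B\<close>.\<close>

lemma distal_join3:
  fixes E :: "'x \<Rightarrow> (nat \<Rightarrow> 'b) \<Rightarrow> 'z"
  assumes "distal E"
  obtains k C where "finite C"
    "\<And>B x. finite B \<Longrightarrow> B \<noteq> {} \<Longrightarrow> \<exists>ps c. length ps = k \<and> set ps \<subseteq> B \<and> c \<in> C \<and> x \<in> c ps \<and>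
      (\<forall>x'\<in>c ps. \<forall>p\<in>B. \<forall>q\<in>B. \<forall>r\<in>B. E x' (join3 p q r) = E x (join3 p q r))"
proof -
  obtain k C where C: "finite C" "\<And>B x. finite B \<Longrightarrow> B \<noteq> {} \<Longrightarrow> \<exists>ps c. length ps = k \<and> set ps \<subseteq> B \<and>
      c \<in> C \<and> x \<in> c ps \<and> (\<forall>x'\<in>c ps. \<forall>b\<in>B. E x' b = E x b)"
    by (rule distalE[OF assms(1)], rule that)
  let ?s = "\<lambda>ps. map (\<lambda>i. join3 (ps ! i) (ps ! (k + i)) (ps ! (2 * k + i))) [0..<k]"
  let ?C = "(\<lambda>c ps. c (?s ps)) ` C"
  show thesis
  proof (rule that[of ?C "3 * k"])
    show "finite ?C" using C(1) by simp
    fix B x assume B: "finite (B :: (nat \<Rightarrow> 'b) set)" "B \<noteq> {}"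
    let ?B = "(\<lambda>(p, q, r). join3 p q r) ` (B \<times> B \<times> B)"
    obtain ps c where c: "length ps = k" "set ps \<subseteq> ?B" "c \<in> C" "x \<in> c ps" "\<forall>x'\<in>c ps. \<forall>b\<in>?B. E x' b = E x b"
      using C(2)[of ?B x] B by auto
    have "\<forall>z\<in>set ps. \<exists>t. fst t \<in> B \<and> fst (snd t) \<in> B \<and> snd (snd t) \<in> B \<and> z = join3 (fst t) (fst (snd t)) (snd (snd t))"
      using c(2) by force
    from bchoice[OF this] obtain t where t: "\<And>z. z \<in> set ps \<Longrightarrow> fst (t z) \<in> B \<and> fst (snd (t z)) \<in> B \<and>
      snd (snd (t z)) \<in> B \<and> z = join3 (fst (t z)) (fst (snd (t z))) (snd (snd (t z)))" by blast
    let ?l = "map (fst \<circ> t) ps @ map (fst \<circ> snd \<circ> t) ps @ map (snd \<circ> snd \<circ> t) ps"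
    have sl: "?s ?l = ps"
      using c(1) t by (intro nth_equalityI) (auto simp: nth_append)
    have mem: "join3 p q r \<in> ?B" if "p \<in> B" "q \<in> B" "r \<in> B" for p q r
      using that by (intro image_eqI[of _ _ "(p, q, r)"]) auto
    have "x \<in> c (?s ?l)" "\<forall>x'\<in>c (?s ?l). \<forall>p\<in>B. \<forall>q\<in>B. \<forall>r\<in>B. E x' (join3 p q r) = E x (join3 p q r)"
      unfolding sl using c(4,5) mem by blast+
    moreover have "length ?l = 3 * k" "set ?l \<subseteq> B" using c(1) t by auto
    moreover have "(\<lambda>ps. c (?s ps)) \<in> ?C" using c(3) by blast
    ultimately show "\<exists>ps c. length ps = 3 * k \<and> set ps \<subseteq> B \<and> c \<in> ?C \<and> x \<in> c ps \<and>
      (\<forall>x'\<in>c ps. \<forall>p\<in>B. \<forall>q\<in>B. \<forall>r\<in>B. E x' (join3 p q r) = E x (join3 p q r))"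
      by (intro exI[of _ ?l] exI[of _ "\<lambda>ps. c (?s ps)"] conjI)
  qed
qed

lemma finite_chain_least:
  assumes "finite F" "F \<noteq> {}" "\<And>U V. U \<in> F \<Longrightarrow> V \<in> F \<Longrightarrow> U \<subseteq> V \<or> V \<subseteq> U"
  shows "\<exists>U\<in>F. \<forall>V\<in>F. U \<subseteq> V"
  using assms
proof (induction F rule: finite_ne_induct)
  case (insert x F)
  then obtain U where U: "U \<in> F" "\<forall>V\<in>F. U \<subseteq> V" by blast
  have "x \<subseteq> U \<or> U \<subseteq> x" using insert.prems U(1) by blast
  then show ?case
  proof
    assume "x \<subseteq> U"
    then have "\<forall>V\<in>insert x F. x \<subseteq> V" using U(2) by blast
    then show ?thesis by blast
  next
    assume "U \<subseteq> x"
    then show ?thesis using U by blast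
  qed
qed simp

text \<open>\<open>P\<close> makes the numbers of elements below \<open>t\<close> and below
  \<open>t'\<close> equal, which clears \<open>[t, t')\<close>. \<open>Q\<close> does so for the
  elements at most \<open>t\<close> and at most \<open>t'\<close>, which clears \<open>t'\<close>.
  Thresholds up to \<open>N\<close> see these numbers exactly because
  \<open>card X \<le> N\<close>.\<close>

lemma boundary_cuts:
  fixes X :: "'a::linordered_field set"
  assumes X: "finite X" "card X \<le> N" and le: "t < t'"
    and P: "\<And>i. i \<le> N \<Longrightarrow> count_below i X t \<longleftrightarrow> count_below i X t'"
    and Q: "\<And>i. i \<le> N \<Longrightarrow> (\<forall>v. t < v \<longrightarrow> count_below i X v) \<longleftrightarrow> (\<forall>v. t' < v \<longrightarrow> count_below i X v)"
  shows "{t..t'} \<inter> X = {}"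
proof (rule ccontr)
  assume "\<not> ?thesis"
  then obtain u where u: "u \<in> X" "t \<le> u" "u \<le> t'" by auto
  note cb = count_below_iff[OF X(1)]
  have fin: "finite {w \<in> X. R w}" for R using X(1) by simp
  have N: "card {w \<in> X. R w} \<le> N" for R using card_mono[OF X(1), of "{w \<in> X. R w}"] X(2) by auto
  show False
  proof (cases "u < t'")
    case True
    have "{w \<in> X. w < t} \<subseteq> {w \<in> X. w < t'}" using le by auto
    moreover have "u \<in> {w \<in> X. w < t'}" "u \<notin> {w \<in> X. w < t}" using u True by simp_all
    ultimately have "{w \<in> X. w < t} \<subset> {w \<in> X. w < t'}" by blast
    then have "card {w \<in> X. w < t} < card {w \<in> X. w < t'}" by (rule psubset_card_mono[OF fin])
    then show False using P[OF N, of "\<lambda>w. w < t'"] by (simp add: cb)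
  next
    case False
    then have ut: "u = t'" using u by simp
    let ?j = "card {w \<in> X. w \<le> t'}"
    have "count_below ?j X v" if "t' < v" for v
      unfolding cb using that by (intro card_mono fin) auto
    then have all: "\<forall>v. t < v \<longrightarrow> count_below ?j X v" using Q[OF N, of "\<lambda>w. w \<le> t'"] by simp
    have "{w \<in> X. w < t'} \<subseteq> {w \<in> X. w \<le> t'}" by auto
    moreover have "u \<in> {w \<in> X. w \<le> t'}" "u \<notin> {w \<in> X. w < t'}" using u ut by simp_all
    ultimately have "{w \<in> X. w < t'} \<subset> {w \<in> X. w \<le> t'}" by blast
    then have less: "card {w \<in> X. w < t'} < ?j" by (rule psubset_card_mono[OF fin])
    show False using all[rule_format, OF le] less by (simp add: cb)
  qed
qed

section \<open>Distality of definable relations\<close>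

context o_minimal_structure
begin

lemma boundary_connected:
  assumes X: "dset X" and le: "t \<le> t'" and b: "{t..t'} \<inter> boundary X = {}"
  shows "t \<in> X \<longleftrightarrow> t' \<in> X"
proof (rule definable_connected[OF X le])
  fix s assume "t \<le> s" "s \<le> t'"
  then have "s \<notin> boundary X" using b by auto
  then obtain \<epsilon> where "\<epsilon> > 0" "(\<forall>y. \<bar>y - s\<bar> < \<epsilon> \<longrightarrow> y \<notin> X) \<or> (\<forall>y. \<bar>y - s\<bar> < \<epsilon> \<longrightarrow> y \<in> X)"
    unfolding boundary_def by blast
  moreover from this(1) have "\<bar>s - s\<bar> < \<epsilon>" by simp
  ultimately show "\<exists>\<delta>>0. \<forall>s'. t \<le> s' \<and> s' \<le> t' \<and> \<bar>s' - s\<bar> < \<delta> \<longrightarrow> (s' \<in> X \<longleftrightarrow> s \<in> X)" by blast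
qed

text \<open>Half-lines stand in for endpoints: each \<open>K c\<close> is upward closed in the new
  coordinate \<open>t\<close>, so the range of \<open>t\<close> in a cell is a half-line of one
  parameter \<open>p\<close> minus a half-line of one parameter \<open>q\<close>. Half-lines are
  nested, so the tightest ones around \<open>t\<close> come from a single \<open>p\<close> and a
  single \<open>q\<close>, however large \<open>B\<close> is.\<close>

theorem distal_definable:
  fixes E :: "(nat \<Rightarrow> 'a) \<Rightarrow> (nat \<Rightarrow> 'a) \<Rightarrow> bool"
  assumes "dfn (\<lambda>e. E (\<lambda>i. e (Inl i)) (\<lambda>i. e (Inr i)))"
    and "\<And>x x'. (\<And>i. i < n \<Longrightarrow> x i = x' i) \<Longrightarrow> E x = E x'"
  shows "distal E"
  using assms
proof (induction n arbitrary: E)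
  case 0
  have "E = (\<lambda>x. E (\<lambda>_. 0))" by (rule ext, rule 0(2)) simp
  then show ?case by (rule ssubst) (rule distal_const)
next
  case (Suc n)
  have ren: "dfn (\<lambda>e. E (case_nat (e k) (\<lambda>i. e (h i))) (\<lambda>i. e (h' i)))"
    for h h' :: "nat \<Rightarrow> 'i" and k
  proof -
    have "(\<lambda>i. e (case i of 0 \<Rightarrow> k | Suc i \<Rightarrow> h i)) = case_nat (e k) (\<lambda>i. e (h i))" for e :: "'i \<Rightarrow> 'a"
      by (auto split: nat.split)
    then show ?thesis using dfn_rename[OF Suc.prems(1), of "case_sum (case_nat k h) h'"] by simp
  qed
  define X where "X x b = {t. E (case_nat t x) b}" for x b
  have dX: "dset (X x b)" for x b
  proof -
    let ?e = "case_sum x b :: nat + nat \<Rightarrow> 'a"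
    have "dset {t. E (case_nat t (\<lambda>i. ?e (Inl i))) (\<lambda>i. ?e (Inr i))}"
      by (rule dset_slice[of "\<lambda>e t. E (case_nat t (\<lambda>i. e (Inl i))) (\<lambda>i. e (Inr i))"]) (rule ren)
    then show ?thesis by (simp add: X_def)
  qed
  define bd where "bd x b = boundary (X x b)" for x b
  have finbd: "finite (bd x b)" for x b unfolding bd_def by (rule tame_boundary_finite[OF dset_tame[OF dX]])
  have dbd: "dfn (\<lambda>e. e k \<in> bd (\<lambda>i. e (h i)) (\<lambda>i. e (h' i)))" for h h' :: "nat \<Rightarrow> 'i" and k
    unfolding bd_def boundary_def X_def mem_Collect_eq by (intro dfn_intros ren)
  \<comment> \<open>\<open>uniform_finiteness\<close> takes one parameter sequence, so
    \<open>x\<close> and \<open>b\<close> are placed on its even and odd entries.\<close>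
  have "\<exists>N. \<forall>e. card (bd (\<lambda>i. e (2 * i)) (\<lambda>i. e (2 * i + 1))) \<le> N"
    by (rule uniform_finiteness[OF dbd finbd])
  then obtain N where N': "card (bd (\<lambda>i. e (2 * i)) (\<lambda>i. e (2 * i + 1))) \<le> N" for e by blast
  have N: "card (bd x b) \<le> N" for x b
    using N'[of "\<lambda>i. if even i then x (i div 2) else b (i div 2)"] by simp
  \<comment> \<open>With \<open>strict\<close>, at least \<open>i\<close> boundary points lie below
    \<open>t\<close>; without it, at least \<open>i\<close> lie at or below \<open>t\<close>, the
    quantifier over \<open>v\<close> turning \<open><\<close> into \<open>\<le>\<close>.\<close>
  define K where "K = (\<lambda>(i, strict) x b t. if strict then count_below i (bd x b) t
    else (\<forall>v. t < v \<longrightarrow> count_below i (bd x b) v))"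
  have dcb: "dfn (\<lambda>e. count_below j (bd (\<lambda>i. e (h i)) (\<lambda>i. e (h' i))) (e k))"
    for h h' :: "nat \<Rightarrow> 'i" and k j
    using dfn_rename[OF dfn_count_below[OF dbd[of None "\<lambda>i. Some (Inl i)" "\<lambda>i. Some (Inr i)"]],
      of j "case_option k (case_sum h h')"] by simp
  have dK: "dfn (\<lambda>e. K c (\<lambda>i. e (h i)) (\<lambda>i. e (h' i)) (e k))" for h h' :: "nat \<Rightarrow> 'i" and k c
  proof (cases c)
    case (Pair i strict)
    then show ?thesis unfolding K_def by (cases strict) (simp_all add: dfn_intros dcb)
  qed
  have mono_cb: "count_below i (bd x b) t'" if "count_below i (bd x b) t" "t \<le> t'" for i x b t t'
  proof -
    have "card {u \<in> bd x b. u < t} \<le> card {u \<in> bd x b. u < t'}"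
      using that(2) finbd by (intro card_mono) auto
    then show ?thesis using that(1) by (simp add: count_below_iff[OF finbd])
  qed
  have mono: "K c x b t'" if "K c x b t" "t \<le> t'" for c x b t t'
    using that mono_cb[of _ x b t t'] unfolding K_def by (cases c) (auto split: if_splits)
  \<comment> \<open>Index \<open>0\<close> always holds and \<open>Suc N\<close> never does, as
    there are at most \<open>N\<close> boundary points: they act as the ends
    \<open>-\<infinity>\<close> and \<open>\<infinity>\<close>.\<close>
  let ?I = "{..Suc N} \<times> (UNIV :: bool set)"
  have agree: "E (case_nat t x) b \<longleftrightarrow> E (case_nat t' x) b"
    if "\<And>c. c \<in> ?I \<Longrightarrow> K c x b t \<longleftrightarrow> K c x b t'" for x b t t'
  proof -
    have *: "E (case_nat t x) b \<longleftrightarrow> E (case_nat t' x) b"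
      if lt: "t < t'" and K: "\<And>c. c \<in> ?I \<Longrightarrow> K c x b t \<longleftrightarrow> K c x b t'" for t t'
    proof -
      have "{t..t'} \<inter> bd x b = {}"
      proof (rule boundary_cuts[OF finbd N lt])
        fix i assume "i \<le> N"
        then show "count_below i (bd x b) t \<longleftrightarrow> count_below i (bd x b) t'"
          "(\<forall>v. t < v \<longrightarrow> count_below i (bd x b) v) \<longleftrightarrow> (\<forall>v. t' < v \<longrightarrow> count_below i (bd x b) v)"
          using K[of "(i, True)"] K[of "(i, False)"] unfolding K_def by simp_all
      qed
      then have "t \<in> X x b \<longleftrightarrow> t' \<in> X x b" using lt unfolding bd_def by (intro boundary_connected[OF dX]) simp_all
      then show ?thesis by (simp add: X_def)
    qed
    consider "t < t'" | "t = t'" | "t' < t" by fastforce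
    then show ?thesis
    proof cases
      case 1 then show ?thesis using that by (rule *)
    next
      case 3
      then show ?thesis using *[of t' t] that by blast
    qed simp
  qed
  \<comment> \<open>With \<open>z = join3 p q r\<close>: on the interval that \<open>p\<close> and
    \<open>q\<close> cut out over \<open>x\<close>, the parameter \<open>r\<close> has the constant
    truth value \<open>\<sigma>\<close>.\<close>
  define H where "H = (\<lambda>(c, d, \<sigma>) x z. \<forall>t. K c x (\<lambda>i. z (3 * i)) t \<and> \<not> K d x (\<lambda>i. z (Suc (3 * i))) t \<longrightarrow>
    E (case_nat t x) (\<lambda>i. z (Suc (Suc (3 * i)))) = \<sigma>)"
  let ?J = "?I \<times> ?I \<times> (UNIV :: bool set)"
  have "distal (H j)" for j
  proof (rule Suc.IH)
    obtain c d \<sigma> where j: "j = (c, d, \<sigma>)" by (cases j)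
    show "dfn (\<lambda>e. H j (\<lambda>i. e (Inl i)) (\<lambda>i. e (Inr i)))"
      unfolding j H_def prod.case by (intro dfn_intros dK ren)
    fix x x' :: "nat \<Rightarrow> 'a"
    assume xx': "\<And>i. i < n \<Longrightarrow> x i = x' i"
    have E: "E (case_nat t x) = E (case_nat t x')" for t
      by (rule Suc.prems(2)) (auto split: nat.split intro: xx')
    then have "K c x = K c x'" for c unfolding K_def bd_def X_def by (cases c) simp
    then show "H j x = H j x'" unfolding j H_def using E by simp
  qed
  then have dH: "distal (\<lambda>x z. {j \<in> ?J. H j x z})" by (intro distal_finite_family) auto
  obtain k C where C: "finite C" "\<And>B x. finite B \<Longrightarrow> B \<noteq> {} \<Longrightarrow> \<exists>ps c. length ps = k \<and> set ps \<subseteq> B \<and> c \<in> C \<and> x \<in> c ps \<and>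
      (\<forall>x'\<in>c ps. \<forall>p\<in>B. \<forall>q\<in>B. \<forall>r\<in>B. {j \<in> ?J. H j x' (join3 p q r)} = {j \<in> ?J. H j x (join3 p q r)})"
    by (rule distal_join3[OF dH], rule that)
  \<comment> \<open>The first two parameters bound the first coordinate; the remaining
    \<open>k\<close> describe a cell for the other coordinates.\<close>
  define cell where "cell = (\<lambda>(c, i, j) ps. {x. (\<lambda>i. x (Suc i)) \<in> c (drop 2 ps) \<and>
    K i (\<lambda>i. x (Suc i)) (ps ! 0) (x 0) \<and> \<not> K j (\<lambda>i. x (Suc i)) (ps ! 1) (x 0)})"
  show ?case
  proof (rule distalI[of "cell ` (C \<times> ?I \<times> ?I)" "k + 2"])
    show "finite (cell ` (C \<times> ?I \<times> ?I))" using C(1) by simp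
    fix B :: "(nat \<Rightarrow> 'a) set" and x :: "nat \<Rightarrow> 'a" assume B: "finite B" "B \<noteq> {}"
    define y t where "y = (\<lambda>i. x (Suc i))" and "t = x 0"
    have x: "x = case_nat t y" by (auto simp: y_def t_def split: nat.split)
    obtain ps c where c: "length ps = k" "set ps \<subseteq> B" "c \<in> C" "y \<in> c ps"
      "\<forall>y'\<in>c ps. \<forall>p\<in>B. \<forall>q\<in>B. \<forall>r\<in>B. {j \<in> ?J. H j y' (join3 p q r)} = {j \<in> ?J. H j y (join3 p q r)}"
      using C(2)[OF B] by blast
    have Heq: "H j y' (join3 p q r) \<longleftrightarrow> H j y (join3 p q r)"
      if "y' \<in> c ps" "p \<in> B" "q \<in> B" "r \<in> B" "j \<in> ?J" for y' p q r j
      using c(5) that by blast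
    \<comment> \<open>\<open>U\<close> and \<open>D\<close> collect the upward and the downward
      half-lines from \<open>B\<close> that contain \<open>t\<close>; the least member of each
      becomes a side of the cell.\<close>
    define U where "U = {V. \<exists>i\<in>?I. \<exists>b\<in>B. K i y b t \<and> V = {s. K i y b s}}"
    define D where "D = {V. \<exists>i\<in>?I. \<exists>b\<in>B. \<not> K i y b t \<and> V = {s. \<not> K i y b s}}"
    have up: "{s. K i y b s} \<subseteq> {s. K j y b' s} \<or> {s. K j y b' s} \<subseteq> {s. K i y b s}" for i j b b'
    proof (rule ccontr)
      assume "\<not> ?thesis"
      then obtain s s' where *: "K i y b s" "\<not> K j y b' s" "K j y b' s'" "\<not> K i y b s'" by blast
      show False using mono[of i y b s s'] mono[of j y b' s' s] * by (cases "s \<le> s'") auto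
    qed
    obtain b0 where b0: "b0 \<in> B" using B(2) by blast
    have "U \<subseteq> (\<Union>i\<in>?I. (\<lambda>b. {s. K i y b s}) ` B)" "D \<subseteq> (\<Union>i\<in>?I. (\<lambda>b. {s. \<not> K i y b s}) ` B)"
      unfolding U_def D_def by blast+
    moreover have "finite (\<Union>i\<in>?I. (\<lambda>b. {s. K i y b s}) ` B)" "finite (\<Union>i\<in>?I. (\<lambda>b. {s. \<not> K i y b s}) ` B)"
      using B(1) by simp_all
    ultimately have fin: "finite U" "finite D" by (meson finite_subset)+
    have K0: "K (0, True) y b0 t" unfolding K_def by simp
    have "card {u \<in> bd y b0. u < t} \<le> card (bd y b0)" by (intro card_mono finbd) auto
    then have K1: "\<not> K (Suc N, True) y b0 t"
      unfolding K_def using N[of y b0] by (simp add: count_below_iff[OF finbd] del: count_below.simps)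
    have ne: "U \<noteq> {}" "D \<noteq> {}" using b0 K0 K1 unfolding U_def D_def by blast+
    have chU: "V \<subseteq> W \<or> W \<subseteq> V" if "V \<in> U" "W \<in> U" for V W
    proof -
      obtain i b j b' where "V = {s. K i y b s}" "W = {s. K j y b' s}"
        using \<open>V \<in> U\<close> \<open>W \<in> U\<close> unfolding U_def by blast
      then show ?thesis using up[of i b j b'] by simp
    qed
    have chD: "V \<subseteq> W \<or> W \<subseteq> V" if "V \<in> D" "W \<in> D" for V W
    proof -
      obtain i b j b' where "V = {s. \<not> K i y b s}" "W = {s. \<not> K j y b' s}"
        using \<open>V \<in> D\<close> \<open>W \<in> D\<close> unfolding D_def by blast
      then show ?thesis using up[of i b j b'] by blast
    qed
    obtain V where V: "V \<in> U" "\<forall>V'\<in>U. V \<subseteq> V'"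
      using finite_chain_least[OF fin(1) ne(1) chU] by blast
    obtain W where W: "W \<in> D" "\<forall>W'\<in>D. W \<subseteq> W'"
      using finite_chain_least[OF fin(2) ne(2) chD] by blast
    obtain i p where i: "i \<in> ?I" "p \<in> B" "K i y p t" "V = {s. K i y p s}" using V(1) unfolding U_def by blast
    obtain j q where j: "j \<in> ?I" "q \<in> B" "\<not> K j y q t" "W = {s. \<not> K j y q s}" using W(1) unfolding D_def by blast
    \<comment> \<open>No cut from \<open>B\<close> separates \<open>s\<close> from \<open>t\<close>:
      one that holds at \<open>t\<close> contains \<open>V\<close>, and one that fails at
      \<open>t\<close> has a complement containing \<open>W\<close>.\<close>
    have const: "E (case_nat s y) b \<longleftrightarrow> E (case_nat t y) b" if b: "b \<in> B" and s: "K i y p s" "\<not> K j y q s" for s b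
    proof (rule agree)
      fix c assume c: "c \<in> ?I"
      show "K c y b s \<longleftrightarrow> K c y b t"
      proof (cases "K c y b t")
        case True
        then have "{s. K c y b s} \<in> U" using c b unfolding U_def by blast
        then have "V \<subseteq> {s. K c y b s}" using V(2) by blast
        then show ?thesis using True s i(4) by blast
      next
        case False
        then have "{s. \<not> K c y b s} \<in> D" using c b unfolding D_def by blast
        then have "W \<subseteq> {s. \<not> K c y b s}" by (rule W(2)[rule_format])
        moreover have "s \<in> W" using s(2) j(4) by simp
        ultimately have "s \<in> {s. \<not> K c y b s}" by (rule subsetD)
        then show ?thesis using False by simp
      qed
    qed
    let ?ps = "p # q # ps"
    show "\<exists>ps. length ps = k + 2 \<and> set ps \<subseteq> B \<and>
        (\<exists>c\<in>cell ` (C \<times> ?I \<times> ?I). x \<in> c ps \<and> (\<forall>x'\<in>c ps. \<forall>b\<in>B. E x' b = E x b))"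
    proof (intro exI[of _ ?ps] conjI bexI[of _ "cell (c, i, j)"] ballI)
      show "length ?ps = k + 2" "set ?ps \<subseteq> B" using c i j by auto
      show "x \<in> cell (c, i, j) ?ps" unfolding cell_def using c(4) i(3) j(3) by (simp add: y_def t_def)
      show "cell (c, i, j) \<in> cell ` (C \<times> ?I \<times> ?I)" using c(3) i(1) j(1) by blast
      fix x' b assume x': "x' \<in> cell (c, i, j) ?ps" and b: "b \<in> B"
      define y' t' where "y' = (\<lambda>i. x' (Suc i))" and "t' = x' 0"
      have x'_eq: "x' = case_nat t' y'" by (auto simp: y'_def t'_def split: nat.split)
      have y': "y' \<in> c ps" "K i y' p t'" "\<not> K j y' q t'" using x' unfolding cell_def by (simp_all add: y'_def t'_def)
      \<comment> \<open>The cell for the other coordinates preserves this statement, so it holds at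
        \<open>y'\<close> too; evaluated at \<open>t'\<close> it transports the truth value.\<close>
      have "H (i, j, E x b) y (join3 p q b)"
        unfolding H_def prod.case join3_nth using const[OF b] by (simp add: x)
      then have "H (i, j, E x b) y' (join3 p q b)" using Heq[OF y'(1) i(2) j(2) b] i(1) j(1) by simp
      then show "E x' b = E x b"
        unfolding H_def prod.case join3_nth using y'(2,3) x'_eq by blast
    qed
  qed
qed

end

section \<open>Homogeneous pairs by sampling\<close>

lemma exponential_dominates: "\<exists>r. k < r \<and> M * r ^ k < (2::nat) ^ r"
proof -
  \<comment> \<open>The witness is \<open>r = 2 ^ q\<close>: then
    \<open>M * r ^ k < 2 ^ (M + q * k)\<close>, and the exponent is at most
    \<open>q ^ 2 \<le> 2 ^ q\<close>. The summand \<open>4\<close> secures the last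
    inequality.\<close>
  define q where "q = k + M + 4"
  have sq: "n ^ 2 \<le> 2 ^ n" if "4 \<le> n" for n :: nat
    using that
  proof (induction n rule: dec_induct)
    case (step n)
    have "(Suc n)\<^sup>2 = n\<^sup>2 + (2 * n + 1)" by (simp add: power2_eq_square)
    also have "2 * n + 1 \<le> n * n" using mult_le_mono1[OF step(1), of n] step(1) by linarith
    also have "n\<^sup>2 + n * n = 2 * n\<^sup>2" by (simp add: power2_eq_square)
    also have "\<dots> \<le> 2 ^ Suc n" using step by simp
    finally show ?case by simp
  qed simp
  have "M * (2 ^ q) ^ k < 2 ^ M * (2 ^ q) ^ k" by (simp add: less_exp)
  also have "\<dots> = 2 ^ (M + q * k)" by (simp add: power_add power_mult)
  also have "\<dots> \<le> 2 ^ (2 ^ q)"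
  proof (rule power_increasing)
    have "M + q * k \<le> q * M + q * k" by (simp add: q_def)
    also have "\<dots> \<le> q ^ 2" by (simp add: q_def power2_eq_square algebra_simps)
    also have "\<dots> \<le> 2 ^ q" by (rule sq) (simp add: q_def)
    finally show "M + q * k \<le> 2 ^ q" .
  qed simp
  finally have "M * (2 ^ q) ^ k < 2 ^ (2 ^ q)" .
  moreover have "k < 2 ^ q" using le_less_trans[OF _ less_exp, of k q] by (simp add: q_def)
  ultimately show ?thesis by blast
qed

text \<open>Each of the \<open>r - card I\<close> free draws is confined to at most half of the
  \<open>n\<close> values and so gains a factor two.\<close>

lemma card_PiE_half:
  fixes r n m :: nat
  assumes I: "I \<subseteq> {..<r}" and B: "finite B'" and half: "2 * card B' \<le> n"
  shows "2 ^ (r - card I) * card (PiE {..<r} (\<lambda>i. if i \<in> I then {g i} else B')) \<le> n ^ (r - card I)"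
proof -
  have fin: "finite I" using I finite_subset by blast
  have "card (PiE {..<r} (\<lambda>i. if i \<in> I then {g i} else B')) = (\<Prod>i<r. if i \<in> I then 1 else card B')"
    by (subst card_PiE) (auto intro: prod.cong)
  also have "\<dots> = card B' ^ card ({..<r} - I)"
    by (subst prod.If_cases) (auto simp: Diff_eq)
  also have "card ({..<r} - I) = r - card I" using I fin by (simp add: card_Diff_subset)
  finally show ?thesis using power_mono[OF half, of "r - card I"] by (simp add: power_mult_distrib)
qed

text \<open>
  Random sampling: among the \<open>n ^ r\<close> samples, those for which some cell built from the sample is
  crossed by at least half of \<open>B\<close>, but by no member of the sample, are too few to exhaust all.
\<close>

lemma good_sample:
  fixes C :: "('y list \<Rightarrow> 'c) set" and cross :: "'c \<Rightarrow> 'y \<Rightarrow> bool"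
  assumes C: "finite C" and B: "finite B" "B \<noteq> {}" and r: "k < r" "card C * 2 ^ k * r ^ k < 2 ^ r"
  shows "\<exists>B0\<subseteq>B. B0 \<noteq> {} \<and> card B0 \<le> r \<and> (\<forall>ps c. length ps = k \<and> set ps \<subseteq> B0 \<and> c \<in> C \<and> (\<forall>b\<in>B0. \<not> cross (c ps) b) \<longrightarrow>
    2 * card {b \<in> B. cross (c ps) b} < card B)"
proof (rule ccontr)
  assume neg: "\<not> ?thesis"
  define n where "n = card B"
  define \<Omega> where "\<Omega> = PiE {..<r} (\<lambda>_. B)"
  \<comment> \<open>A list in \<open>L\<close> names the draws that serve as the \<open>k\<close>
    parameters of a cell; a union bound runs over the \<open>r ^ k\<close> such lists.\<close>
  define L where "L = {is. set is \<subseteq> {..<r} \<and> length is = k}"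
  define heavy where "heavy c \<longleftrightarrow> n \<le> 2 * card {b \<in> B. cross c b}" for c
  define bad where "bad is = {f \<in> \<Omega>. \<exists>c\<in>C. heavy (c (map f is)) \<and> (\<forall>i<r. \<not> cross (c (map f is)) (f i))}" for "is"
  have finL: "finite L" and cardL: "card L = r ^ k"
    unfolding L_def using finite_lists_length_eq[of "{..<r}" k] card_lists_length_eq[of "{..<r}" k] by auto
  have cov: "\<Omega> \<subseteq> (\<Union>is\<in>L. bad is)"
  proof
    fix f assume f: "f \<in> \<Omega>"
    let ?B0 = "f ` {..<r}"
    have sub: "?B0 \<subseteq> B" using f unfolding \<Omega>_def by auto
    have "card ?B0 \<le> r" using card_image_le[of "{..<r}" f] by simp
    moreover have "?B0 \<noteq> {}" using r(1) by auto
    ultimately obtain ps c where c: "length ps = k" "set ps \<subseteq> ?B0" "c \<in> C" "\<forall>b\<in>?B0. \<not> cross (c ps) b" "heavy (c ps)"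
      using neg sub unfolding heavy_def n_def not_less[symmetric] by blast
    have "\<forall>p\<in>set ps. \<exists>i. i < r \<and> f i = p" using c(2) by auto
    from bchoice[OF this] obtain h where h: "\<forall>p\<in>set ps. h p < r \<and> f (h p) = p" by blast
    have "map f (map h ps) = ps" using h by (simp add: map_idI)
    moreover have "map h ps \<in> L" using h c(1) unfolding L_def by auto
    ultimately show "f \<in> (\<Union>is\<in>L. bad is)" using f c unfolding bad_def
      by (intro UN_I[of "map h ps"]) (auto simp del: map_map)
  qed
  have bound: "2 ^ r * card (bad is) \<le> card C * 2 ^ k * n ^ r" if "is": "is \<in> L" for "is"
  proof -
    define I where "I = set is"
    have I: "I \<subseteq> {..<r}" "card I \<le> k" "finite I"
      using "is" card_length[of "is"] unfolding I_def L_def by auto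
    have ir: "card I \<le> r" using I(2) r(1) by simp
    \<comment> \<open>Fixing the draws in \<open>I\<close> to \<open>g\<close> fixes the cell as
      well; the other draws then have to avoid the members of \<open>B\<close> that cross it, at
      least half of \<open>B\<close> if the cell is heavy.\<close>
    define \<Psi> where "\<Psi> g c = PiE {..<r} (\<lambda>i. if i \<in> I then {g i} else B - {b \<in> B. cross (c (map g is)) b})" for g c
    define P where "P = {(g, c) \<in> PiE I (\<lambda>_. B) \<times> C. heavy (c (map g is))}"
    have sub: "bad is \<subseteq> (\<Union>(g, c)\<in>P. \<Psi> g c)"
    proof
      fix f assume "f \<in> bad is"
      then obtain c where c: "f \<in> \<Omega>" "c \<in> C" "heavy (c (map f is))" "\<forall>i<r. \<not> cross (c (map f is)) (f i)"
        unfolding bad_def by blast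
      let ?g = "restrict f I"
      have m: "map ?g is = map f is" by (simp add: I_def)
      have "?g \<in> PiE I (\<lambda>_. B)" using c(1) I(1) unfolding \<Omega>_def by auto
      moreover have "heavy (c (map ?g is))" unfolding m by (rule c(3))
      ultimately have "(?g, c) \<in> P" unfolding P_def using c(2) by blast
      moreover have "f \<in> \<Psi> ?g c"
        using c(1,4) I(1) unfolding \<Psi>_def m \<Omega>_def by (auto simp: PiE_iff)
      ultimately show "f \<in> (\<Union>(g, c)\<in>P. \<Psi> g c)" by blast
    qed
    have finPI: "finite (PiE I (\<lambda>_. B))" using I(3) B(1) by (intro finite_PiE) auto
    have Psub: "P \<subseteq> PiE I (\<lambda>_. B) \<times> C" unfolding P_def by auto
    have finP: "finite P" using finite_subset[OF Psub] finPI C by simp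
    have cardP: "card P \<le> n ^ card I * card C"
      using card_mono[OF _ Psub] finPI C I(3) by (simp add: card_cartesian_product card_PiE n_def)
    have each: "2 ^ (r - card I) * card (\<Psi> g c) \<le> n ^ (r - card I)" if "(g, c) \<in> P" for g c
      unfolding \<Psi>_def
    proof (rule card_PiE_half[OF I(1)])
      have "card (B - {b \<in> B. cross (c (map g is)) b}) = n - card {b \<in> B. cross (c (map g is)) b}"
        using B(1) unfolding n_def by (intro card_Diff_subset) auto
      then show "2 * card (B - {b \<in> B. cross (c (map g is)) b}) \<le> n"
        using that unfolding P_def heavy_def by auto
    qed (use B(1) in simp)
    have fin\<Psi>: "finite (\<Psi> g c)" for g c unfolding \<Psi>_def using B(1) by (intro finite_PiE) auto
    have "card (bad is) \<le> card (\<Union>(g, c)\<in>P. \<Psi> g c)"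
      using finP fin\<Psi> by (intro card_mono sub) auto
    also have "\<dots> \<le> (\<Sum>(g, c)\<in>P. card (\<Psi> g c))"
      using card_UN_le[OF finP, of "\<lambda>(g, c). \<Psi> g c"] by (simp add: case_prod_beta)
    finally have "2 ^ (r - card I) * card (bad is) \<le> (\<Sum>(g, c)\<in>P. 2 ^ (r - card I) * card (\<Psi> g c))"
      by (simp add: sum_distrib_left[symmetric] case_prod_beta)
    also have "\<dots> \<le> (\<Sum>(g, c)\<in>P. n ^ (r - card I))" using each by (intro sum_mono) auto
    also have "\<dots> = card P * n ^ (r - card I)" by (simp add: case_prod_beta)
    also have "\<dots> \<le> (n ^ card I * card C) * n ^ (r - card I)" using cardP by (rule mult_le_mono1)
    also have "\<dots> = card C * n ^ r" using ir by (simp add: power_add[symmetric])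
    finally have *: "2 ^ (r - card I) * card (bad is) \<le> card C * n ^ r" .
    \<comment> \<open>At most \<open>k\<close> draws are spent on parameters; this loses the factor
      \<open>2 ^ k\<close>.\<close>
    have "2 ^ r * card (bad is) = 2 ^ card I * (2 ^ (r - card I) * card (bad is))"
      using ir by (simp add: power_add[symmetric])
    also have "\<dots> \<le> 2 ^ k * (card C * n ^ r)" using I(2) by (intro mult_le_mono[OF _ *] power_increasing) auto
    finally show ?thesis by (simp add: ac_simps)
  qed
  have fin\<Omega>: "finite \<Omega>" unfolding \<Omega>_def using B(1) by (intro finite_PiE) auto
  have "n ^ r = card \<Omega>" unfolding \<Omega>_def n_def by (simp add: card_PiE)
  also have "\<dots> \<le> card (\<Union>is\<in>L. bad is)"
    using finL fin\<Omega> by (intro card_mono cov finite_UN_I) (auto simp: bad_def)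
  also have "\<dots> \<le> (\<Sum>is\<in>L. card (bad is))" by (rule card_UN_le[OF finL])
  finally have "2 ^ r * n ^ r \<le> (\<Sum>is\<in>L. 2 ^ r * card (bad is))"
    by (simp add: sum_distrib_left[symmetric])
  also have "\<dots> \<le> (\<Sum>is\<in>L. card C * 2 ^ k * n ^ r)" using bound by (rule sum_mono)
  also have "\<dots> = (card C * 2 ^ k * r ^ k) * n ^ r" by (simp add: cardL)
  finally have "2 ^ r * n ^ r \<le> (card C * 2 ^ k * r ^ k) * n ^ r" .
  moreover have "n ^ r > 0" using B unfolding n_def by (simp add: card_gt_0_iff)
  ultimately show False using r(2) by simp
qed

text \<open>The cells built from a sample \<open>B0\<close> of bounded size and crossed by no member
  of it cover \<open>A\<close> and number fewer than \<open>M\<close>, so one contains a fraction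
  \<open>1 / M\<close> of \<open>A\<close>. Fewer than half of \<open>B\<close> cross it; on the
  rest of \<open>B\<close> the relation depends on the parameter alone, and one truth value is taken
  on at least a quarter of \<open>B\<close>.\<close>

theorem distal_homogeneous:
  fixes E :: "'x \<Rightarrow> 'y \<Rightarrow> bool"
  assumes "distal E"
  shows "\<exists>\<epsilon>::real. 0 < \<epsilon> \<and> \<epsilon> < 1 \<and> (\<forall>A B. finite A \<and> finite B \<longrightarrow>
    (\<exists>A'\<subseteq>A. \<exists>B'\<subseteq>B. \<epsilon> * card A \<le> card A' \<and> \<epsilon> * card B \<le> card B' \<and>
      ((\<forall>x\<in>A'. \<forall>y\<in>B'. E x y) \<or> (\<forall>x\<in>A'. \<forall>y\<in>B'. \<not> E x y))))"
proof -
  obtain k C where C: "finite C" "\<And>B x. finite B \<Longrightarrow> B \<noteq> {} \<Longrightarrow> \<exists>ps c. length ps = k \<and> set ps \<subseteq> B \<and>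
      c \<in> C \<and> x \<in> c ps \<and> (\<forall>x'\<in>c ps. \<forall>b\<in>B. E x' b = E x b)"
    by (rule distalE[OF assms(1)], rule that)
  obtain r where r: "k < r" "card C * 2 ^ k * r ^ k < 2 ^ r" using exponential_dominates by blast
  define M where "M = r ^ k * card C + 1"
  \<comment> \<open>Covers both losses, \<open>1 / M\<close> in \<open>A\<close> and
    \<open>1 / 4\<close> in \<open>B\<close>.\<close>
  define \<epsilon> where "\<epsilon> = 1 / (4 * real M)"
  have M: "real M \<ge> 1" by (simp add: M_def)
  have \<epsilon>: "0 < \<epsilon>" "\<epsilon> < 1" "\<epsilon> \<le> 1 / 4" "\<epsilon> \<le> 1 / real M" using M by (auto simp: \<epsilon>_def field_simps)
  define cross where "cross c b \<longleftrightarrow> (\<exists>x\<in>c. \<exists>x'\<in>c. E x b \<noteq> E x' b)" for c b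
  have "\<exists>A'\<subseteq>A. \<exists>B'\<subseteq>B. \<epsilon> * card A \<le> card A' \<and> \<epsilon> * card B \<le> card B' \<and>
      ((\<forall>x\<in>A'. \<forall>y\<in>B'. E x y) \<or> (\<forall>x\<in>A'. \<forall>y\<in>B'. \<not> E x y))" if fin: "finite A" "finite B" for A B
  proof (cases "A = {} \<or> B = {}")
    case True
    have le: "\<epsilon> * card X \<le> card X" for X :: "'z set" using \<epsilon> by (simp add: mult_left_le_one_le)
    show ?thesis by (intro exI[of _ A] exI[of _ B] conjI) (use True le in auto)
  next
    case False
    then have "\<exists>B0\<subseteq>B. B0 \<noteq> {} \<and> card B0 \<le> r \<and> (\<forall>ps c. length ps = k \<and> set ps \<subseteq> B0 \<and> c \<in> C \<and>
        (\<forall>b\<in>B0. \<not> cross (c ps) b) \<longrightarrow> 2 * card {b \<in> B. cross (c ps) b} < card B)"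
      using good_sample[OF C(1) fin(2) _ r, of cross] by blast
    then obtain B0 where B0: "B0 \<subseteq> B" "B0 \<noteq> {}" "card B0 \<le> r"
      "\<And>ps c. length ps = k \<Longrightarrow> set ps \<subseteq> B0 \<Longrightarrow> c \<in> C \<Longrightarrow> \<forall>b\<in>B0. \<not> cross (c ps) b \<Longrightarrow>
        2 * card {b \<in> B. cross (c ps) b} < card B"
      by blast
    have finB0: "finite B0" using B0(1) fin(2) finite_subset by blast
    define Q where "Q = {ps. set ps \<subseteq> B0 \<and> length ps = k} \<times> C"
    have Q: "finite Q" unfolding Q_def using finB0 C(1) by (simp add: finite_lists_length_eq)
    have "card Q = card B0 ^ k * card C"
      unfolding Q_def using finB0 by (simp add: card_cartesian_product card_lists_length_eq)
    also have "\<dots> \<le> r ^ k * card C" using B0(3) by (intro mult_le_mono1 power_mono) auto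
    also have "\<dots> < M" by (simp add: M_def)
    finally have cardQ: "card Q < M" .
    define U where "U = {(ps, c) \<in> Q. \<forall>b\<in>B0. \<not> cross (c ps) b}"
    have U: "finite U" "card U < M"
    proof -
      have "U \<subseteq> Q" unfolding U_def by blast
      then show "finite U" "card U < M"
        using finite_subset[OF _ Q] le_less_trans[OF card_mono[OF Q] cardQ] by blast+
    qed
    have cov: "A \<subseteq> (\<Union>u\<in>U. A \<inter> snd u (fst u))"
    proof
      fix x assume x: "x \<in> A"
      obtain ps c where c: "length ps = k" "set ps \<subseteq> B0" "c \<in> C" "x \<in> c ps" "\<forall>x'\<in>c ps. \<forall>b\<in>B0. E x' b = E x b"
        using C(2)[OF finB0 B0(2)] by blast
      have "\<forall>b\<in>B0. \<not> cross (c ps) b" using c(5) unfolding cross_def by blast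
      then have "(ps, c) \<in> U" unfolding U_def Q_def using c(1-3) by blast
      then show "x \<in> (\<Union>u\<in>U. A \<inter> snd u (fst u))" using c(4) x by (intro UN_I[of "(ps, c)"]) auto
    qed
    have Apos: "card A > 0" using False fin by (simp add: card_gt_0_iff)
    have "\<exists>u\<in>U. card A \<le> M * card (A \<inter> snd u (fst u))"
    proof (rule ccontr)
      assume "\<not> ?thesis"
      then have less: "M * card (A \<inter> snd u (fst u)) \<le> card A" if "u \<in> U" for u using that by force
      have "card A \<le> card (\<Union>u\<in>U. A \<inter> snd u (fst u))" using U(1) fin(1) by (intro card_mono cov) auto
      also have "\<dots> \<le> (\<Sum>u\<in>U. card (A \<inter> snd u (fst u)))" by (rule card_UN_le[OF U(1)])
      finally have "M * card A \<le> (\<Sum>u\<in>U. M * card (A \<inter> snd u (fst u)))"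
        by (simp add: sum_distrib_left[symmetric])
      also have "\<dots> \<le> (\<Sum>u\<in>U. card A)" by (rule sum_mono[OF less])
      also have "\<dots> = card U * card A" by simp
      also have "\<dots> < M * card A" using U(2) Apos by simp
      finally show False by simp
    qed
    then obtain ps c where u: "(ps, c) \<in> U" and big: "card A \<le> M * card (A \<inter> c ps)" by auto
    define A' where "A' = A \<inter> c ps"
    have "A' \<noteq> {}" using big Apos unfolding A'_def by auto
    then obtain x0 where x0: "x0 \<in> A'" by blast
    define B1 where "B1 = {b \<in> B. \<not> cross (c ps) b}"
    have "2 * card {b \<in> B. cross (c ps) b} < card B"
      using u B0(4) unfolding U_def Q_def by blast
    moreover have "card {b \<in> B. cross (c ps) b} + card B1 = card B"
      unfolding B1_def using fin(2) by (subst card_Un_disjoint[symmetric]) (auto intro: arg_cong[of _ _ card])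
    moreover have "card {b \<in> B1. E x0 b} + card {b \<in> B1. \<not> E x0 b} = card B1"
      unfolding B1_def using fin(2) by (subst card_Un_disjoint[symmetric]) (auto intro: arg_cong[of _ _ card])
    ultimately consider "card B \<le> 4 * card {b \<in> B1. E x0 b}" | "card B \<le> 4 * card {b \<in> B1. \<not> E x0 b}"
      by linarith
    then obtain B' \<sigma> where B': "B' \<subseteq> B1" "card B \<le> 4 * card B'" "\<forall>b\<in>B'. E x0 b = \<sigma>"
    proof cases
      case 1 then show thesis by (intro that[of "{b \<in> B1. E x0 b}" True]) auto
    next
      case 2 then show thesis by (intro that[of "{b \<in> B1. \<not> E x0 b}" False]) auto
    qed
    have hom: "E x b = \<sigma>" if "x \<in> A'" "b \<in> B'" for x b
    proof -
      have "\<not> cross (c ps) b" using B'(1) that(2) unfolding B1_def by blast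
      then have "E x b = E x0 b" using that(1) x0 unfolding cross_def A'_def by blast
      then show ?thesis using B'(3) that(2) by blast
    qed
    have "real (card A) \<le> real M * real (card A')" using big unfolding A'_def of_nat_mult[symmetric] of_nat_le_iff .
    then have "card A / real M \<le> card A'" using M by (simp add: field_simps)
    moreover have "\<epsilon> * card A \<le> 1 / real M * card A" using \<epsilon>(4) by (intro mult_right_mono) auto
    ultimately have "\<epsilon> * card A \<le> card A'" by simp
    moreover have "\<epsilon> * card B \<le> 1 / 4 * card B" using \<epsilon>(3) by (intro mult_right_mono) auto
    then have "\<epsilon> * card B \<le> card B'" using B'(2) by simp
    moreover have "A' \<subseteq> A" "B' \<subseteq> B" using B'(1) unfolding A'_def B1_def by auto
    moreover have "(\<forall>x\<in>A'. \<forall>y\<in>B'. E x y) \<or> (\<forall>x\<in>A'. \<forall>y\<in>B'. \<not> E x y)" using hom by (cases \<sigma>) auto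
    ultimately show ?thesis by blast
  qed
  then show ?thesis using \<epsilon>(1,2) by blast
qed

theorem theorem2p6:
  fixes S :: "nat \<Rightarrow> 'a::real_closed_field list set set"
    and l :: nat
    and F :: "'a list set"
  assumes "o_minimal_structure S"
    and "F \<in> S (l + l)"
    and "closedin (euclidean_space_topology (l + l)) F"
  shows "\<exists>\<epsilon>::real. 0 < \<epsilon> \<and> \<epsilon> < 1 \<and>
    (\<forall>(n::nat) Y. Y \<subseteq> affine_space l \<and> finite Y \<and> card Y = n \<longrightarrow>
      (\<exists>Y\<^sub>1 Y\<^sub>2. Y\<^sub>1 \<subseteq> Y \<and> Y\<^sub>2 \<subseteq> Y \<and>
        real (card Y\<^sub>1) \<ge> \<epsilon> * real n \<and> real (card Y\<^sub>2) \<ge> \<epsilon> * real n \<and>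
        ((\<forall>y\<in>Y\<^sub>1. \<forall>z\<in>Y\<^sub>2. y @ z \<in> F) \<or> (\<forall>y\<in>Y\<^sub>1. \<forall>z\<in>Y\<^sub>2. y @ z \<notin> F))))"
proof -
  interpret o_minimal_structure S by fact
  \<comment> \<open>Points become sequences on all of \<open>nat\<close>, of which \<open>E\<close>
    reads the first \<open>l\<close> entries on either side; a list \<open>y\<close> will enter as
    \<open>(!) y\<close>.\<close>
  define E where "E x y \<longleftrightarrow> map x [0..<l] @ map y [0..<l] \<in> F" for x y :: "nat \<Rightarrow> 'a"
  have "dfn (\<lambda>e. E (\<lambda>i. e (Inl i)) (\<lambda>i. e (Inr i)))"
  proof (rule dfnI)
    show "F \<in> S (length (map Inl [0..<l] @ map Inr [0..<l] :: (nat + nat) list))" using assms(2) by simp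
  qed (simp add: E_def comp_def)
  moreover have "E x = E x'" if "\<And>i. i < l \<Longrightarrow> x i = x' i" for x x'
  proof -
    have eq: "map x [0..<l] = map x' [0..<l]" using that by simp
    show ?thesis by (intro ext) (simp only: E_def eq)
  qed
  ultimately have "distal E" by (rule distal_definable)
  then have "distal (\<lambda>y z. E ((!) y) ((!) z))" by (rule distal_compose)
  from distal_homogeneous[OF this] obtain \<epsilon> :: real where \<epsilon>: "0 < \<epsilon>" "\<epsilon> < 1"
    "\<forall>A B. finite A \<and> finite B \<longrightarrow> (\<exists>A'\<subseteq>A. \<exists>B'\<subseteq>B. \<epsilon> * card A \<le> card A' \<and> \<epsilon> * card B \<le> card B' \<and>
      ((\<forall>y\<in>A'. \<forall>z\<in>B'. E ((!) y) ((!) z)) \<or> (\<forall>y\<in>A'. \<forall>z\<in>B'. \<not> E ((!) y) ((!) z))))"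
    by (elim exE conjE)
  have E_nth: "E ((!) y) ((!) z) \<longleftrightarrow> y @ z \<in> F" if "y \<in> affine_space l" "z \<in> affine_space l" for y z
    using that map_nth[of y] map_nth[of z] by (simp add: E_def affine_space_def)
  show ?thesis
  proof (intro exI[of _ \<epsilon>] conjI \<epsilon>(1,2) allI impI, elim conjE)
    fix n and Y :: "'a list set"
    assume Y: "Y \<subseteq> affine_space l" "finite Y" "card Y = n"
    \<comment> \<open>The bipartite statement is applied with both sides equal to
      \<open>Y\<close>.\<close>
    obtain A B where AB: "A \<subseteq> Y" "B \<subseteq> Y" "\<epsilon> * card Y \<le> card A" "\<epsilon> * card Y \<le> card B"
      "(\<forall>y\<in>A. \<forall>z\<in>B. E ((!) y) ((!) z)) \<or> (\<forall>y\<in>A. \<forall>z\<in>B. \<not> E ((!) y) ((!) z))"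
      using \<epsilon>(3)[rule_format, OF conjI[OF Y(2) Y(2)]] by (elim bexE exE conjE) (rule that)
    have "E ((!) y) ((!) z) \<longleftrightarrow> y @ z \<in> F" if "y \<in> A" "z \<in> B" for y z
      using that AB(1,2) Y(1) by (intro E_nth) auto
    then have "(\<forall>y\<in>A. \<forall>z\<in>B. y @ z \<in> F) \<or> (\<forall>y\<in>A. \<forall>z\<in>B. y @ z \<notin> F)" using AB(5) by blast
    then show "\<exists>Y\<^sub>1 Y\<^sub>2. Y\<^sub>1 \<subseteq> Y \<and> Y\<^sub>2 \<subseteq> Y \<and>
        real (card Y\<^sub>1) \<ge> \<epsilon> * real n \<and> real (card Y\<^sub>2) \<ge> \<epsilon> * real n \<and>
        ((\<forall>y\<in>Y\<^sub>1. \<forall>z\<in>Y\<^sub>2. y @ z \<in> F) \<or> (\<forall>y\<in>Y\<^sub>1. \<forall>z\<in>Y\<^sub>2. y @ z \<notin> F))"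
      using AB(1-4) Y(3) by (intro exI[of _ A] exI[of _ B]) simp
  qed
qed

end
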